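(* Let $(A,\cdot,+)$ be a linear cycle set and $\Gamma$ be an abelian group. Associating to a central cycle-type extension $0\to\Gamma\overset{\iota}{\to}E\overset{\pi}{\to}A\to 0$ the class in $RH^2(A;\Gamma)$ of the reduced $2$-cocycle $f\colon A\times A\to\Gamma$ determined by $$\iota(f(a,a'))=s(a)\cdot s(a')-s(a\cdot a'),\qquad a,a'\in A,$$ where $s\colon A\to E$ is any section of $\pi$ that is a homomorphism for $+$, yields a well-defined bijective correspondence $$\operatorname{CTExt}(A,\Gamma)\overset{1:1}{\longleftrightarrow}RH^2(A;\Gamma).$$
   Context: A cycle set is a set $X$ with a binary operation $\cdot$ such that all left translations $a\mapsto b\cdot a$ are bijective and $(a\cdot b)\cdot(a\cdot c)=(b\cdot a)\cdot(b\cdot c)$ for all $a,b,c$. A linear cycle set (LCS) is a cycle set $(A,\cdot)$ with an abelian group operation $+$ satisfying $a\cdot(b+c)=a\cdot b+a\cdot c$ and $(a+b)\cdot c=(a\cdot b)\cdot(a\cdot c)$ for all $a,b,c\in A$. A morphism of LCS is a map preserving $+$ and $\cdot$; its kernel is the preimage of $0$; short exact sequences of LCS are defined accordingly (injective, image equals kernel, surjective). A linear cycle subset $A'$ of an LCS $B$ is central if $b\cdot a'=a'$ and $a'\cdot b=b$ for all $b\in B$, $a'\in A'$. A central cycle-type extension of $A$ by $\Gamma$ is a short exact sequence of LCS $0\to\Gamma\overset{\iota}{\to}E\overset{\pi}{\to}A\to 0$, where $\Gamma$ has the trivial cycle set structure $\gamma\cdot\gamma'=\gamma'$, $\iota(\Gamma)$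 is central in $E$, and the underlying short exact sequence of abelian groups splits. Two such extensions $(E,\iota,\pi)$, $(E',\iota',\pi')$ are equivalent if there is an LCS isomorphism $\varphi\colon E\to E'$ with $\varphi\iota=\iota'$ and $\pi'\varphi=\pi$. $\operatorname{CTExt}(A,\Gamma)$ is the set of equivalence classes. A reduced $2$-cocycle of $A$ with values in $\Gamma$ is a map $f\colon A\times A\to\Gamma$ with $f(a,b+c)=f(a,b)+f(a,c)$ and $f(a+b,c)=f(a\cdot b,a\cdot c)+f(a,c)$ for all $a,b,c\in A$; these form an abelian group $RZ^2(A;\Gamma)$. A reduced $2$-coboundary is a map of the form $(a,b)\mapsto\theta(a\cdot b)-\theta(b)$ with $\theta\colon A\to\Gamma$ a group homomorphism for $+$; these form a subgroup $RB^2(A;\Gamma)$. $RH^2(A;\Gamma)=RZ^2(A;\Gamma)/RB^2(A;\Gamma)$. *)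

theory Defs
  imports "HOL-Algebra.Coset"
begin

text \<open>
  Abelian groups are HOL-Algebra commutative groups, so the additive operation of a linear cycle
  set, its neutral element and its negatives are written \<open>\<otimes>\<close>, \<open>\<one>\<close> and \<open>inv\<close>.
  The cycle set operation is an additional record field, written \<open>\<cdot>\<close>.
\<close>

record 'a lcs = "'a monoid" +
  cyc :: "['a, 'a] \<Rightarrow> 'a" (infixl \<open>\<cdot>\<index>\<close> 71)

definition cycle_set :: "'a set \<Rightarrow> ('a \<Rightarrow> 'a \<Rightarrow> 'a) \<Rightarrow> bool" where
  "cycle_set X d \<longleftrightarrow>
     (\<forall>b\<in>X. bij_betw (d b) X X) \<and>
     (\<forall>a\<in>X. \<forall>b\<in>X. \<forall>c\<in>X. d (d a b) (d a c) = d (d b a) (d b c))"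

locale linear_cycle_set = comm_group A for A (structure) +
  assumes cycle_set: "cycle_set (carrier A) (cyc A)"
    and cyc_add_right:
      "\<lbrakk>a \<in> carrier A; b \<in> carrier A; c \<in> carrier A\<rbrakk> \<Longrightarrow> a \<cdot> (b \<otimes> c) = (a \<cdot> b) \<otimes> (a \<cdot> c)"
    and cyc_add_left:
      "\<lbrakk>a \<in> carrier A; b \<in> carrier A; c \<in> carrier A\<rbrakk> \<Longrightarrow> (a \<otimes> b) \<cdot> c = (a \<cdot> b) \<cdot> (a \<cdot> c)"

definition lcs_hom :: "('a, 'r) lcs_scheme \<Rightarrow> ('b, 's) lcs_scheme \<Rightarrow> ('a \<Rightarrow> 'b) set" where
  "lcs_hom A B =
     {h \<in> hom A B. \<forall>x\<in>carrier A. \<forall>y\<in>carrier A. h (x \<cdot>\<^bsub>A\<^esub> y) = h x \<cdot>\<^bsub>B\<^esub> h y}"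

definition lcs_iso :: "('a, 'r) lcs_scheme \<Rightarrow> ('b, 's) lcs_scheme \<Rightarrow> ('a \<Rightarrow> 'b) set" where
  "lcs_iso A B = {h \<in> lcs_hom A B. bij_betw h (carrier A) (carrier B)}"

definition lcs_short_exact ::
  "('g, 'q) lcs_scheme \<Rightarrow> ('e, 's) lcs_scheme \<Rightarrow> ('a, 'r) lcs_scheme \<Rightarrow>
   ('g \<Rightarrow> 'e) \<Rightarrow> ('e \<Rightarrow> 'a) \<Rightarrow> bool" where
  "lcs_short_exact G E A \<iota> \<pi> \<longleftrightarrow>
     linear_cycle_set G \<and> linear_cycle_set E \<and> linear_cycle_set A \<and>
     \<iota> \<in> lcs_hom G E \<and> \<pi> \<in> lcs_hom E A \<and>
     inj_on \<iota> (carrier G) \<and> \<iota> ` carrier G = kernel E A \<pi> \<and> \<pi> ` carrier E = carrier A"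

definition linear_cycle_subset :: "'b set \<Rightarrow> ('b, 's) lcs_scheme \<Rightarrow> bool" where
  "linear_cycle_subset A' B \<longleftrightarrow> A' \<subseteq> carrier B \<and> linear_cycle_set (B\<lparr>carrier := A'\<rparr>)"

definition central_lcs_subset :: "'b set \<Rightarrow> ('b, 's) lcs_scheme \<Rightarrow> bool" where
  "central_lcs_subset A' B \<longleftrightarrow>
     linear_cycle_subset A' B \<and>
     (\<forall>b\<in>carrier B. \<forall>a'\<in>A'. b \<cdot>\<^bsub>B\<^esub> a' = a' \<and> a' \<cdot>\<^bsub>B\<^esub> b = b)"

definition trivial_lcs :: "('g, 'q) monoid_scheme \<Rightarrow> 'g lcs" where
  "trivial_lcs \<Gamma> =
     \<lparr>carrier = carrier \<Gamma>, mult = mult \<Gamma>, one = one \<Gamma>, cyc = (\<lambda>\<gamma> \<gamma>'. \<gamma>')\<rparr>"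

definition additive_sections ::
  "('a, 'r) lcs_scheme \<Rightarrow> 'e lcs \<Rightarrow> ('e \<Rightarrow> 'a) \<Rightarrow> ('a \<Rightarrow> 'e) set" where
  "additive_sections A E \<pi> = {s \<in> hom A E. \<forall>a\<in>carrier A. \<pi> (s a) = a}"

text \<open>The last condition is the splitting of the underlying sequence of abelian groups.\<close>

definition central_ct_extension ::
  "('a, 'r) lcs_scheme \<Rightarrow> ('g, 'q) monoid_scheme \<Rightarrow>
   'e lcs \<Rightarrow> ('g \<Rightarrow> 'e) \<Rightarrow> ('e \<Rightarrow> 'a) \<Rightarrow> bool" where
  "central_ct_extension A \<Gamma> E \<iota> \<pi> \<longleftrightarrow>
     lcs_short_exact (trivial_lcs \<Gamma>) E A \<iota> \<pi> \<and>
     central_lcs_subset (\<iota> ` carrier \<Gamma>) E \<and>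
     additive_sections A E \<pi> \<noteq> {}"

definition equivalent_extensions ::
  "('g, 'q) monoid_scheme \<Rightarrow> 'e lcs \<Rightarrow> ('g \<Rightarrow> 'e) \<Rightarrow> ('e \<Rightarrow> 'a) \<Rightarrow>
   'f lcs \<Rightarrow> ('g \<Rightarrow> 'f) \<Rightarrow> ('f \<Rightarrow> 'a) \<Rightarrow> bool" where
  "equivalent_extensions \<Gamma> E \<iota> \<pi> E' \<iota>' \<pi>' \<longleftrightarrow>
     (\<exists>\<phi>\<in>lcs_iso E E'.
        (\<forall>\<gamma>\<in>carrier \<Gamma>. \<phi> (\<iota> \<gamma>) = \<iota>' \<gamma>) \<and> (\<forall>e\<in>carrier E. \<pi>' (\<phi> e) = \<pi> e))"

text \<open>
  \<open>CTExt\<close> collects the equivalence classes of those extensions whose carrier is a subset of a given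
  type \<open>'e\<close>. Since the abelian group underlying an extension is isomorphic to the product of
  \<open>\<Gamma>\<close> and \<open>A\<close>, the type \<open>'g \<times> 'a\<close> is large enough to represent all classes.
\<close>

type_synonym ('g, 'e, 'a) extension = "'e lcs \<times> ('g \<Rightarrow> 'e) \<times> ('e \<Rightarrow> 'a)"

definition CTExt ::
  "('a, 'r) lcs_scheme \<Rightarrow> ('g, 'q) monoid_scheme \<Rightarrow> ('g, 'e, 'a) extension set set" where
  "CTExt A \<Gamma> =
     {(E, \<iota>, \<pi>). central_ct_extension A \<Gamma> E \<iota> \<pi>} //
     {((E, \<iota>, \<pi>), (E', \<iota>', \<pi>')).
        central_ct_extension A \<Gamma> E \<iota> \<pi> \<and> central_ct_extension A \<Gamma> E' \<iota>' \<pi>' \<and>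
        equivalent_extensions \<Gamma> E \<iota> \<pi> E' \<iota>' \<pi>'}"

text \<open>Maps on \<open>A \<times> A\<close> are extensional functions, so that they are equal iff they agree on \<open>A \<times> A\<close>.\<close>

definition RZ2 ::
  "('a, 'r) lcs_scheme \<Rightarrow> ('g, 'q) monoid_scheme \<Rightarrow> ('a \<times> 'a \<Rightarrow> 'g) monoid" where
  "RZ2 A \<Gamma> =
     \<lparr>carrier =
        {f \<in> carrier A \<times> carrier A \<rightarrow>\<^sub>E carrier \<Gamma>.
           \<forall>a\<in>carrier A. \<forall>b\<in>carrier A. \<forall>c\<in>carrier A.
             f (a, b \<otimes>\<^bsub>A\<^esub> c) = f (a, b) \<otimes>\<^bsub>\<Gamma>\<^esub> f (a, c) \<and>
             f (a \<otimes>\<^bsub>A\<^esub> b, c) = f (a \<cdot>\<^bsub>A\<^esub> b, a \<cdot>\<^bsub>A\<^esub> c) \<otimes>\<^bsub>\<Gamma>\<^esub> f (a, c)},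
      mult = (\<lambda>f g. \<lambda>p\<in>carrier A \<times> carrier A. f p \<otimes>\<^bsub>\<Gamma>\<^esub> g p),
      one = (\<lambda>p\<in>carrier A \<times> carrier A. \<one>\<^bsub>\<Gamma>\<^esub>)\<rparr>"

definition RB2 ::
  "('a, 'r) lcs_scheme \<Rightarrow> ('g, 'q) monoid_scheme \<Rightarrow> ('a \<times> 'a \<Rightarrow> 'g) set" where
  "RB2 A \<Gamma> =
     (\<lambda>\<theta>. \<lambda>(a, b)\<in>carrier A \<times> carrier A. \<theta> (a \<cdot>\<^bsub>A\<^esub> b) \<otimes>\<^bsub>\<Gamma>\<^esub> inv\<^bsub>\<Gamma>\<^esub> (\<theta> b)) ` hom A \<Gamma>"

definition RH2 ::
  "('a, 'r) lcs_scheme \<Rightarrow> ('g, 'q) monoid_scheme \<Rightarrow> ('a \<times> 'a \<Rightarrow> 'g) set monoid" where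
  "RH2 A \<Gamma> = RZ2 A \<Gamma> Mod RB2 A \<Gamma>"

definition section_cocycle ::
  "('a, 'r) lcs_scheme \<Rightarrow> ('g, 'q) monoid_scheme \<Rightarrow> 'e lcs \<Rightarrow> ('g \<Rightarrow> 'e) \<Rightarrow>
   ('a \<Rightarrow> 'e) \<Rightarrow> ('a \<times> 'a \<Rightarrow> 'g) \<Rightarrow> bool" where
  "section_cocycle A \<Gamma> E \<iota> s f \<longleftrightarrow>
     f \<in> carrier A \<times> carrier A \<rightarrow>\<^sub>E carrier \<Gamma> \<and>
     (\<forall>a\<in>carrier A. \<forall>a'\<in>carrier A.
        \<iota> (f (a, a')) = (s a \<cdot>\<^bsub>E\<^esub> s a') \<otimes>\<^bsub>E\<^esub> inv\<^bsub>E\<^esub> (s (a \<cdot>\<^bsub>A\<^esub> a')))"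

text \<open>That this description determines a unique class is part of the theorem.\<close>

definition RH2_class ::
  "('a, 'r) lcs_scheme \<Rightarrow> ('g, 'q) monoid_scheme \<Rightarrow> 'e lcs \<Rightarrow> ('g \<Rightarrow> 'e) \<Rightarrow>
   ('e \<Rightarrow> 'a) \<Rightarrow> ('a \<times> 'a \<Rightarrow> 'g) set" where
  "RH2_class A \<Gamma> E \<iota> \<pi> =
     (THE c. \<exists>s\<in>additive_sections A E \<pi>. \<exists>f.
        section_cocycle A \<Gamma> E \<iota> s f \<and> c = RB2 A \<Gamma> #>\<^bsub>RZ2 A \<Gamma>\<^esub> f)"

definition CTExt_to_RH2 ::
  "('a, 'r) lcs_scheme \<Rightarrow> ('g, 'q) monoid_scheme \<Rightarrow>
   ('g, 'e, 'a) extension set \<Rightarrow> ('a \<times> 'a \<Rightarrow> 'g) set" where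
  "CTExt_to_RH2 A \<Gamma> C = the_elem ((\<lambda>(E, \<iota>, \<pi>). RH2_class A \<Gamma> E \<iota> \<pi>) ` C)"

end

theory Submission
  imports Defs
begin

text \<open>
  An additive section \<open>s\<close> gives every element of \<open>E\<close> unique coordinates \<open>\<iota> g + s a\<close>. Centrality of
  \<open>\<iota>(\<Gamma>)\<close> makes \<open>(\<iota> g + s a) \<cdot> (\<iota> h + s b)\<close> independent of \<open>g\<close> and additive in \<open>h\<close>, so in these
  coordinates the product reads \<open>(g, a) \<cdot> (h, b) = (h + f (a, b), a \<cdot> b)\<close>, and the axioms of a linear
  cycle set for \<open>E\<close> are precisely the cocycle equations for \<open>f\<close>. An equivalence of extensions has
  the form \<open>(g, a) \<mapsto> (g + \<theta> a, a)\<close> with \<open>\<theta>\<close> additive, and it respects the products iff the two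
  cocycles differ by the coboundary of \<open>\<theta>\<close>. Independence of the section is the case of the
  identity equivalence with two different sections.
\<close>

text \<open>AC rewriting with \<open>m_ac\<close> nests products to the right, where the plain
  inverse laws no longer match. These forms finish the cancellation in coboundary
  computations.\<close>

lemma (in group) mult_inv_cancel:
  "\<lbrakk>x \<in> carrier G; y \<in> carrier G\<rbrakk> \<Longrightarrow> x \<otimes> (inv x \<otimes> y) = y"
  "\<lbrakk>x \<in> carrier G; y \<in> carrier G\<rbrakk> \<Longrightarrow> inv x \<otimes> (x \<otimes> y) = y"
  by (simp_all flip: m_assoc)

section \<open>Elementary properties of linear cycle sets\<close>

context linear_cycle_set
begin

lemma bij_betw_cyc: "a \<in> carrier A \<Longrightarrow> bij_betw ((\<cdot>) a) (carrier A) (carrier A)"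
  using cycle_set unfolding cycle_set_def by blast

lemma cyc_closed [simp, intro]: "\<lbrakk>a \<in> carrier A; b \<in> carrier A\<rbrakk> \<Longrightarrow> a \<cdot> b \<in> carrier A"
  using bij_betw_cyc bij_betwE by blast

lemma cyc_inj: "\<lbrakk>a \<in> carrier A; b \<in> carrier A; c \<in> carrier A\<rbrakk> \<Longrightarrow> a \<cdot> b = a \<cdot> c \<longleftrightarrow> b = c"
  using bij_betw_cyc[of a] unfolding bij_betw_def inj_on_def by blast

lemma cyc_surj:
  assumes "a \<in> carrier A" "c \<in> carrier A"
  obtains b where "b \<in> carrier A" "a \<cdot> b = c"
  using bij_betw_imp_surj_on[OF bij_betw_cyc[OF assms(1)]] assms(2) by (metis imageE)

lemma cyc_one_right [simp]: "a \<in> carrier A \<Longrightarrow> a \<cdot> \<one> = \<one>"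
  using cyc_add_right[of a \<one> \<one>] by simp

text \<open>The left law at \<open>\<one>\<close> says that translation by \<open>\<one>\<close> is
  idempotent, and an injective idempotent map is the identity.\<close>

lemma cyc_one_left [simp]: "a \<in> carrier A \<Longrightarrow> \<one> \<cdot> a = a"
  using cyc_add_left[of \<one> \<one> a] cyc_inj[of \<one> a "\<one> \<cdot> a"] by simp

end

text \<open>The cycle set identity is the left distributivity law combined with commutativity.\<close>

lemma linear_cycle_setI:
  fixes B (structure)
  assumes "comm_group B"
    and "\<And>b. b \<in> carrier B \<Longrightarrow> bij_betw ((\<cdot>) b) (carrier B) (carrier B)"
    and "\<And>a b c. \<lbrakk>a \<in> carrier B; b \<in> carrier B; c \<in> carrier B\<rbrakk>
      \<Longrightarrow> a \<cdot> (b \<otimes>\<^bsub>B\<^esub> c) = (a \<cdot> b) \<otimes>\<^bsub>B\<^esub> (a \<cdot> c)"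
    and "\<And>a b c. \<lbrakk>a \<in> carrier B; b \<in> carrier B; c \<in> carrier B\<rbrakk>
      \<Longrightarrow> (a \<otimes>\<^bsub>B\<^esub> b) \<cdot> c = (a \<cdot> b) \<cdot> (a \<cdot> c)"
  shows "linear_cycle_set B"
proof -
  interpret B: comm_group B by fact
  show ?thesis
    by unfold_locales (auto simp: cycle_set_def assms(2-3) assms(4)[symmetric] B.m_comm)
qed

text \<open>Exactness asks for a linear cycle set at the left end of the sequence too; this supplies
  it for the model extensions.\<close>

lemma linear_cycle_set_trivial_lcs:
  assumes "comm_group \<Gamma>"
  shows "linear_cycle_set (trivial_lcs \<Gamma>)"
proof -
  interpret comm_group \<Gamma> by fact
  have "comm_group (trivial_lcs \<Gamma>)"
    by (rule comm_groupI) (auto simp: trivial_lcs_def m_ac intro: l_inv_ex)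
  then show ?thesis
    by (rule linear_cycle_setI) (auto simp: trivial_lcs_def bij_betw_def)
qed

section \<open>Reduced cocycles and coboundaries\<close>

locale lcs_coefficients = A: linear_cycle_set A + \<Gamma>: comm_group \<Gamma>
  for A :: "('a, 'r) lcs_scheme" and \<Gamma> :: "('g, 'q) monoid_scheme"
begin

definition coboundary :: "('a \<Rightarrow> 'g) \<Rightarrow> 'a \<times> 'a \<Rightarrow> 'g" where
  "coboundary \<theta> =
     (\<lambda>(a, b)\<in>carrier A \<times> carrier A. \<theta> (a \<cdot>\<^bsub>A\<^esub> b) \<otimes>\<^bsub>\<Gamma>\<^esub> inv\<^bsub>\<Gamma>\<^esub> (\<theta> b))"

lemma coboundary_apply:
  "\<lbrakk>a \<in> carrier A; b \<in> carrier A\<rbrakk> \<Longrightarrow>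
   coboundary \<theta> (a, b) = \<theta> (a \<cdot>\<^bsub>A\<^esub> b) \<otimes>\<^bsub>\<Gamma>\<^esub> inv\<^bsub>\<Gamma>\<^esub> (\<theta> b)"
  by (simp add: coboundary_def)

lemma RB2_eq: "RB2 A \<Gamma> = coboundary ` hom A \<Gamma>"
  by (simp add: RB2_def coboundary_def)

lemma RZ2_closed:
  "\<lbrakk>f \<in> carrier (RZ2 A \<Gamma>); a \<in> carrier A; b \<in> carrier A\<rbrakk> \<Longrightarrow> f (a, b) \<in> carrier \<Gamma>"
  by (auto simp: RZ2_def)

lemma RZ2_add_right:
  "\<lbrakk>f \<in> carrier (RZ2 A \<Gamma>); a \<in> carrier A; b \<in> carrier A; c \<in> carrier A\<rbrakk> \<Longrightarrow>
   f (a, b \<otimes>\<^bsub>A\<^esub> c) = f (a, b) \<otimes>\<^bsub>\<Gamma>\<^esub> f (a, c)"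
  by (simp add: RZ2_def)

lemma RZ2_add_left:
  "\<lbrakk>f \<in> carrier (RZ2 A \<Gamma>); a \<in> carrier A; b \<in> carrier A; c \<in> carrier A\<rbrakk> \<Longrightarrow>
   f (a \<otimes>\<^bsub>A\<^esub> b, c) = f (a \<cdot>\<^bsub>A\<^esub> b, a \<cdot>\<^bsub>A\<^esub> c) \<otimes>\<^bsub>\<Gamma>\<^esub> f (a, c)"
  by (simp add: RZ2_def)

lemma RZ2_one_right [simp]:
  "\<lbrakk>f \<in> carrier (RZ2 A \<Gamma>); a \<in> carrier A\<rbrakk> \<Longrightarrow> f (a, \<one>\<^bsub>A\<^esub>) = \<one>\<^bsub>\<Gamma>\<^esub>"
  using RZ2_add_right[of f a "\<one>\<^bsub>A\<^esub>" "\<one>\<^bsub>A\<^esub>"] RZ2_closed[of f a "\<one>\<^bsub>A\<^esub>"]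
  by simp

text \<open>As \<open>\<one>\<close> acts as the identity, the second cocycle law with both summands
  equal to \<open>\<one>\<close> reads x = x + x. With \<open>RZ2_one_right\<close> this is the
  normalisation that later makes the copy of \<open>\<Gamma>\<close> in a model extension
  central.\<close>

lemma RZ2_one_left [simp]:
  "\<lbrakk>f \<in> carrier (RZ2 A \<Gamma>); a \<in> carrier A\<rbrakk> \<Longrightarrow> f (\<one>\<^bsub>A\<^esub>, a) = \<one>\<^bsub>\<Gamma>\<^esub>"
  using RZ2_add_left[of f "\<one>\<^bsub>A\<^esub>" "\<one>\<^bsub>A\<^esub>" a] RZ2_closed[of f "\<one>\<^bsub>A\<^esub>" a]
  by simp

lemma RZ2_memI:
  assumes "f \<in> carrier A \<times> carrier A \<rightarrow>\<^sub>E carrier \<Gamma>"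
    and "\<And>a b c. \<lbrakk>a \<in> carrier A; b \<in> carrier A; c \<in> carrier A\<rbrakk> \<Longrightarrow>
      f (a, b \<otimes>\<^bsub>A\<^esub> c) = f (a, b) \<otimes>\<^bsub>\<Gamma>\<^esub> f (a, c)"
    and "\<And>a b c. \<lbrakk>a \<in> carrier A; b \<in> carrier A; c \<in> carrier A\<rbrakk> \<Longrightarrow>
      f (a \<otimes>\<^bsub>A\<^esub> b, c) = f (a \<cdot>\<^bsub>A\<^esub> b, a \<cdot>\<^bsub>A\<^esub> c) \<otimes>\<^bsub>\<Gamma>\<^esub> f (a, c)"
  shows "f \<in> carrier (RZ2 A \<Gamma>)"
  using assms by (simp add: RZ2_def)

lemma RZ2_mult_apply:
  "\<lbrakk>a \<in> carrier A; b \<in> carrier A\<rbrakk> \<Longrightarrow>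
   (f \<otimes>\<^bsub>RZ2 A \<Gamma>\<^esub> f') (a, b) = f (a, b) \<otimes>\<^bsub>\<Gamma>\<^esub> f' (a, b)"
  by (simp add: RZ2_def)

lemma RZ2_one_apply:
  "\<lbrakk>a \<in> carrier A; b \<in> carrier A\<rbrakk> \<Longrightarrow> \<one>\<^bsub>RZ2 A \<Gamma>\<^esub> (a, b) = \<one>\<^bsub>\<Gamma>\<^esub>"
  by (simp add: RZ2_def)

lemma extensional_pair_eqI:
  assumes "f \<in> carrier A \<times> carrier A \<rightarrow>\<^sub>E B" "f' \<in> carrier A \<times> carrier A \<rightarrow>\<^sub>E B"
    and "\<And>a b. \<lbrakk>a \<in> carrier A; b \<in> carrier A\<rbrakk> \<Longrightarrow> f (a, b) = f' (a, b)"
  shows "f = f'"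
  by (rule PiE_ext[OF assms(1,2)]) (use assms(3) in auto)

lemma RZ2_eqI:
  assumes "f \<in> carrier (RZ2 A \<Gamma>)" "f' \<in> carrier (RZ2 A \<Gamma>)"
    and "\<And>a b. \<lbrakk>a \<in> carrier A; b \<in> carrier A\<rbrakk> \<Longrightarrow> f (a, b) = f' (a, b)"
  shows "f = f'"
  using assms by (intro extensional_pair_eqI[of f "carrier \<Gamma>" f']) (auto simp: RZ2_def)

lemma RZ2_mult_closed:
  assumes "f \<in> carrier (RZ2 A \<Gamma>)" "f' \<in> carrier (RZ2 A \<Gamma>)"
  shows "f \<otimes>\<^bsub>RZ2 A \<Gamma>\<^esub> f' \<in> carrier (RZ2 A \<Gamma>)"
proof (rule RZ2_memI)
  show "f \<otimes>\<^bsub>RZ2 A \<Gamma>\<^esub> f' \<in> carrier A \<times> carrier A \<rightarrow>\<^sub>E carrier \<Gamma>"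
    using assms by (auto simp: RZ2_def)
qed (use assms in \<open>simp_all add: RZ2_mult_apply RZ2_add_right RZ2_add_left RZ2_closed \<Gamma>.m_ac\<close>)

lemma RZ2_inverse:
  assumes "f \<in> carrier (RZ2 A \<Gamma>)"
  defines "f' \<equiv> \<lambda>p\<in>carrier A \<times> carrier A. inv\<^bsub>\<Gamma>\<^esub> (f p)"
  shows "f' \<in> carrier (RZ2 A \<Gamma>)" and "f' \<otimes>\<^bsub>RZ2 A \<Gamma>\<^esub> f = \<one>\<^bsub>RZ2 A \<Gamma>\<^esub>"
proof -
  show "f' \<in> carrier (RZ2 A \<Gamma>)"
    using assms(1) unfolding f'_def
    by (intro RZ2_memI) (auto simp: RZ2_add_right RZ2_add_left RZ2_closed \<Gamma>.inv_mult)
  show "f' \<otimes>\<^bsub>RZ2 A \<Gamma>\<^esub> f = \<one>\<^bsub>RZ2 A \<Gamma>\<^esub>"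
    using RZ2_closed[OF assms(1)] by (auto simp: RZ2_def f'_def)
qed

lemma RZ2_comm_group: "comm_group (RZ2 A \<Gamma>)"
proof (rule comm_groupI)
  show one: "\<one>\<^bsub>RZ2 A \<Gamma>\<^esub> \<in> carrier (RZ2 A \<Gamma>)"
    by (rule RZ2_memI) (auto simp: RZ2_def)
  show "\<exists>f'\<in>carrier (RZ2 A \<Gamma>). f' \<otimes>\<^bsub>RZ2 A \<Gamma>\<^esub> f = \<one>\<^bsub>RZ2 A \<Gamma>\<^esub>"
    if "f \<in> carrier (RZ2 A \<Gamma>)" for f
    using RZ2_inverse[OF that] by blast
  fix f assume "f \<in> carrier (RZ2 A \<Gamma>)"
  then show "\<one>\<^bsub>RZ2 A \<Gamma>\<^esub> \<otimes>\<^bsub>RZ2 A \<Gamma>\<^esub> f = f"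
    using one by (intro RZ2_eqI RZ2_mult_closed) (auto simp: RZ2_mult_apply RZ2_one_apply RZ2_closed)
qed (auto intro!: RZ2_eqI RZ2_mult_closed simp: RZ2_mult_apply RZ2_closed \<Gamma>.m_ac)

sublocale RZ2: comm_group "RZ2 A \<Gamma>"
  by (rule RZ2_comm_group)

text \<open>The right law holds because \<open>\<theta>\<close> and left translations are additive.
  The left law telescopes: (a + b).c equals (a.b).(a.c), and the two terms
  \<open>\<theta> (a \<cdot> c)\<close> cancel.\<close>

lemma coboundary_RZ2:
  assumes "\<theta> \<in> hom A \<Gamma>"
  shows "coboundary \<theta> \<in> carrier (RZ2 A \<Gamma>)"
proof (rule RZ2_memI)
  note [simp] = coboundary_apply hom_in_carrier[OF assms] hom_mult[OF assms]
  show "coboundary \<theta> \<in> carrier A \<times> carrier A \<rightarrow>\<^sub>E carrier \<Gamma>"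
    by (auto simp: coboundary_def)
  fix a b c assume [simp]: "a \<in> carrier A" "b \<in> carrier A" "c \<in> carrier A"
  show "coboundary \<theta> (a, b \<otimes>\<^bsub>A\<^esub> c) = coboundary \<theta> (a, b) \<otimes>\<^bsub>\<Gamma>\<^esub> coboundary \<theta> (a, c)"
    by (simp add: A.cyc_add_right \<Gamma>.inv_mult \<Gamma>.m_ac)
  show "coboundary \<theta> (a \<otimes>\<^bsub>A\<^esub> b, c) =
      coboundary \<theta> (a \<cdot>\<^bsub>A\<^esub> b, a \<cdot>\<^bsub>A\<^esub> c) \<otimes>\<^bsub>\<Gamma>\<^esub> coboundary \<theta> (a, c)"
    by (simp add: A.cyc_add_left \<Gamma>.m_ac \<Gamma>.mult_inv_cancel)
qed

text \<open>The coboundary depends additively on \<open>\<theta>\<close>, and pointwise sums and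
  negatives of homomorphisms into a commutative group are homomorphisms.\<close>

lemma RB2_subgroup: "subgroup (RB2 A \<Gamma>) (RZ2 A \<Gamma>)"
proof (rule RZ2.subgroupI)
  show "RB2 A \<Gamma> \<subseteq> carrier (RZ2 A \<Gamma>)"
    by (auto simp: RB2_eq coboundary_RZ2)
  have "(\<lambda>_. \<one>\<^bsub>\<Gamma>\<^esub>) \<in> hom A \<Gamma>"
    by (auto simp: hom_def)
  then show "RB2 A \<Gamma> \<noteq> {}"
    by (auto simp: RB2_eq)
next
  fix f assume "f \<in> RB2 A \<Gamma>"
  then obtain \<theta> where \<theta>: "\<theta> \<in> hom A \<Gamma>" and f: "f = coboundary \<theta>"
    by (auto simp: RB2_eq)
  note [simp] = hom_in_carrier[OF \<theta>] hom_mult[OF \<theta>]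
  have \<theta>': "(\<lambda>a. inv\<^bsub>\<Gamma>\<^esub> (\<theta> a)) \<in> hom A \<Gamma>"
    by (rule homI) (simp_all add: \<Gamma>.inv_mult)
  have "coboundary (\<lambda>a. inv\<^bsub>\<Gamma>\<^esub> (\<theta> a)) \<otimes>\<^bsub>RZ2 A \<Gamma>\<^esub> f = \<one>\<^bsub>RZ2 A \<Gamma>\<^esub>"
    using \<theta> \<theta>' by (intro RZ2_eqI)
      (auto simp: f coboundary_RZ2 RZ2_mult_apply RZ2_one_apply coboundary_apply
        \<Gamma>.m_ac \<Gamma>.mult_inv_cancel)
  then have "inv\<^bsub>RZ2 A \<Gamma>\<^esub> f = coboundary (\<lambda>a. inv\<^bsub>\<Gamma>\<^esub> (\<theta> a))"
    using \<theta> \<theta>' by (intro RZ2.inv_equality) (auto simp: f coboundary_RZ2)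
  with \<theta>' show "inv\<^bsub>RZ2 A \<Gamma>\<^esub> f \<in> RB2 A \<Gamma>"
    by (simp add: RB2_eq)
next
  fix f f' assume "f \<in> RB2 A \<Gamma>" "f' \<in> RB2 A \<Gamma>"
  then obtain \<theta> \<theta>' where \<theta>: "\<theta> \<in> hom A \<Gamma>" "\<theta>' \<in> hom A \<Gamma>"
    and f: "f = coboundary \<theta>" "f' = coboundary \<theta>'"
    by (auto simp: RB2_eq)
  note [simp] = hom_in_carrier[OF \<theta>(1)] hom_mult[OF \<theta>(1)] hom_in_carrier[OF \<theta>(2)] hom_mult[OF \<theta>(2)]
  have \<theta>'': "(\<lambda>a. \<theta> a \<otimes>\<^bsub>\<Gamma>\<^esub> \<theta>' a) \<in> hom A \<Gamma>"
    by (rule homI) (simp_all add: \<Gamma>.m_ac)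
  have "f \<otimes>\<^bsub>RZ2 A \<Gamma>\<^esub> f' = coboundary (\<lambda>a. \<theta> a \<otimes>\<^bsub>\<Gamma>\<^esub> \<theta>' a)"
    using \<theta> \<theta>'' by (intro RZ2_eqI)
      (auto simp: f coboundary_RZ2 RZ2_mult_apply coboundary_apply \<Gamma>.inv_mult \<Gamma>.m_ac)
  with \<theta>'' show "f \<otimes>\<^bsub>RZ2 A \<Gamma>\<^esub> f' \<in> RB2 A \<Gamma>"
    by (simp add: RB2_eq)
qed

text \<open>The relation \<open>f' = f + \<partial>\<theta>\<close>, written without negatives.\<close>

lemma RB2_coset_eq_iff:
  assumes f: "f \<in> carrier (RZ2 A \<Gamma>)" and f': "f' \<in> carrier (RZ2 A \<Gamma>)"
  shows "RB2 A \<Gamma> #>\<^bsub>RZ2 A \<Gamma>\<^esub> f = RB2 A \<Gamma> #>\<^bsub>RZ2 A \<Gamma>\<^esub> f' \<longleftrightarrow>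
    (\<exists>\<theta>\<in>hom A \<Gamma>. \<forall>a\<in>carrier A. \<forall>b\<in>carrier A.
       f' (a, b) \<otimes>\<^bsub>\<Gamma>\<^esub> \<theta> b = f (a, b) \<otimes>\<^bsub>\<Gamma>\<^esub> \<theta> (a \<cdot>\<^bsub>A\<^esub> b))"
    (is "_ \<longleftrightarrow> ?R")
proof -
  \<comment> \<open>Cosets partition the group, so their equality amounts to one representative
    lying in the coset of the other.\<close>
  have "RB2 A \<Gamma> #>\<^bsub>RZ2 A \<Gamma>\<^esub> f = RB2 A \<Gamma> #>\<^bsub>RZ2 A \<Gamma>\<^esub> f' \<longleftrightarrow>
      f' \<in> RB2 A \<Gamma> #>\<^bsub>RZ2 A \<Gamma>\<^esub> f"
    using RZ2.repr_independence[OF _ f RB2_subgroup] RZ2.rcos_self[OF f' RB2_subgroup] by metis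
  also have "\<dots> \<longleftrightarrow> (\<exists>\<theta>\<in>hom A \<Gamma>. f' = coboundary \<theta> \<otimes>\<^bsub>RZ2 A \<Gamma>\<^esub> f)"
    by (auto simp: r_coset_def RB2_eq)
  also have "\<dots> \<longleftrightarrow> ?R"
  proof (rule bex_cong[OF refl])
    fix \<theta> assume \<theta>: "\<theta> \<in> hom A \<Gamma>"
    note [simp] = hom_in_carrier[OF \<theta>] RZ2_closed[OF f] RZ2_closed[OF f']
    \<comment> \<open>Both sides are cocycles, hence extensional, so equality can be tested on
      pairs; the negative in the coboundary is then moved across.\<close>
    have "f' = coboundary \<theta> \<otimes>\<^bsub>RZ2 A \<Gamma>\<^esub> f \<longleftrightarrow>
        (\<forall>a\<in>carrier A. \<forall>b\<in>carrier A. f' (a, b) = (coboundary \<theta> \<otimes>\<^bsub>RZ2 A \<Gamma>\<^esub> f) (a, b))"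
      using f f' \<theta> by (blast intro: RZ2_eqI RZ2_mult_closed coboundary_RZ2 dest: arg_cong)
    also have "\<dots> \<longleftrightarrow> (\<forall>a\<in>carrier A. \<forall>b\<in>carrier A.
        f' (a, b) \<otimes>\<^bsub>\<Gamma>\<^esub> \<theta> b = f (a, b) \<otimes>\<^bsub>\<Gamma>\<^esub> \<theta> (a \<cdot>\<^bsub>A\<^esub> b))"
    proof (intro ball_cong refl)
      fix a b assume [simp]: "a \<in> carrier A" "b \<in> carrier A"
      have eq: "(coboundary \<theta> \<otimes>\<^bsub>RZ2 A \<Gamma>\<^esub> f) (a, b) =
          (f (a, b) \<otimes>\<^bsub>\<Gamma>\<^esub> \<theta> (a \<cdot>\<^bsub>A\<^esub> b)) \<otimes>\<^bsub>\<Gamma>\<^esub> inv\<^bsub>\<Gamma>\<^esub> (\<theta> b)"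
        by (simp add: RZ2_mult_apply coboundary_apply \<Gamma>.m_ac)
      show "f' (a, b) = (coboundary \<theta> \<otimes>\<^bsub>RZ2 A \<Gamma>\<^esub> f) (a, b) \<longleftrightarrow>
          f' (a, b) \<otimes>\<^bsub>\<Gamma>\<^esub> \<theta> b = f (a, b) \<otimes>\<^bsub>\<Gamma>\<^esub> \<theta> (a \<cdot>\<^bsub>A\<^esub> b)"
        unfolding eq by (subst \<Gamma>.inv_solve_right) (simp_all add: eq_commute)
    qed
    finally show "f' = coboundary \<theta> \<otimes>\<^bsub>RZ2 A \<Gamma>\<^esub> f \<longleftrightarrow> (\<forall>a\<in>carrier A. \<forall>b\<in>carrier A.
        f' (a, b) \<otimes>\<^bsub>\<Gamma>\<^esub> \<theta> b = f (a, b) \<otimes>\<^bsub>\<Gamma>\<^esub> \<theta> (a \<cdot>\<^bsub>A\<^esub> b))" .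
  qed
  finally show ?thesis .
qed

end

section \<open>Coordinates on an extension given by an additive section\<close>

locale extension_with_section = lcs_coefficients A \<Gamma>
  for A :: "('a, 'r) lcs_scheme" and \<Gamma> :: "('g, 'q) monoid_scheme" +
  fixes E :: "'e lcs" and \<iota> :: "'g \<Rightarrow> 'e" and \<pi> :: "'e \<Rightarrow> 'a" and s :: "'a \<Rightarrow> 'e"
  assumes extension: "central_ct_extension A \<Gamma> E \<iota> \<pi>"
    and section_s: "s \<in> additive_sections A E \<pi>"
begin

sublocale E: linear_cycle_set E
  using extension by (simp add: central_ct_extension_def lcs_short_exact_def)

lemma \<iota>_hom: "\<iota> \<in> hom \<Gamma> E"
  using extension
  by (auto simp: central_ct_extension_def lcs_short_exact_def lcs_hom_def hom_def trivial_lcs_def)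

lemma \<pi>_hom: "\<pi> \<in> hom E A"
  using extension by (auto simp: central_ct_extension_def lcs_short_exact_def lcs_hom_def)

lemma s_hom: "s \<in> hom A E"
  using section_s by (auto simp: additive_sections_def)

lemmas hom_simps [simp] =
  hom_in_carrier[OF \<iota>_hom] hom_in_carrier[OF \<pi>_hom] hom_in_carrier[OF s_hom]
  hom_mult[OF \<iota>_hom] hom_mult[OF \<pi>_hom] hom_mult[OF s_hom]
  hom_one[OF \<iota>_hom \<Gamma>.is_group E.is_group] hom_one[OF s_hom A.is_group E.is_group]

lemma \<pi>_cyc [simp]:
  "\<lbrakk>x \<in> carrier E; y \<in> carrier E\<rbrakk> \<Longrightarrow> \<pi> (x \<cdot>\<^bsub>E\<^esub> y) = \<pi> x \<cdot>\<^bsub>A\<^esub> \<pi> y"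
  using extension by (auto simp: central_ct_extension_def lcs_short_exact_def lcs_hom_def)

lemma \<pi>_s [simp]: "a \<in> carrier A \<Longrightarrow> \<pi> (s a) = a"
  using section_s by (auto simp: additive_sections_def)

lemma \<pi>_\<iota> [simp]: "g \<in> carrier \<Gamma> \<Longrightarrow> \<pi> (\<iota> g) = \<one>\<^bsub>A\<^esub>"
  using extension by (auto simp: central_ct_extension_def lcs_short_exact_def kernel_def trivial_lcs_def)

lemma \<iota>_inj: "\<lbrakk>g \<in> carrier \<Gamma>; h \<in> carrier \<Gamma>\<rbrakk> \<Longrightarrow> \<iota> g = \<iota> h \<longleftrightarrow> g = h"
  using extension
  by (auto simp: central_ct_extension_def lcs_short_exact_def trivial_lcs_def inj_on_def)

lemma kernel_\<pi>:
  assumes "x \<in> carrier E" "\<pi> x = \<one>\<^bsub>A\<^esub>"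
  obtains g where "g \<in> carrier \<Gamma>" "x = \<iota> g"
proof -
  have "\<iota> ` carrier \<Gamma> = kernel E A \<pi>"
    using extension by (simp add: central_ct_extension_def lcs_short_exact_def trivial_lcs_def)
  with assms that show thesis by (auto simp: kernel_def)
qed

lemma \<iota>_central [simp]:
  assumes "x \<in> carrier E" "g \<in> carrier \<Gamma>"
  shows "x \<cdot>\<^bsub>E\<^esub> \<iota> g = \<iota> g" "\<iota> g \<cdot>\<^bsub>E\<^esub> x = x"
  using extension assms by (auto simp: central_ct_extension_def central_lcs_subset_def)

definition coord :: "'g \<Rightarrow> 'a \<Rightarrow> 'e" where
  "coord g a = \<iota> g \<otimes>\<^bsub>E\<^esub> s a"

lemma coord_closed [simp]: "\<lbrakk>g \<in> carrier \<Gamma>; a \<in> carrier A\<rbrakk> \<Longrightarrow> coord g a \<in> carrier E"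
  by (simp add: coord_def)

lemma \<pi>_coord [simp]: "\<lbrakk>g \<in> carrier \<Gamma>; a \<in> carrier A\<rbrakk> \<Longrightarrow> \<pi> (coord g a) = a"
  by (simp add: coord_def)

text \<open>Together with \<open>s_eq_coord\<close> this rewrites \<open>\<iota>\<close> and
  \<open>s\<close> as the two coordinate axes, so that equations in \<open>E\<close> can be split by
  \<open>coord_eq_iff\<close>.\<close>

lemma \<iota>_eq_coord: "g \<in> carrier \<Gamma> \<Longrightarrow> \<iota> g = coord g \<one>\<^bsub>A\<^esub>"
  by (simp add: coord_def)

lemma s_eq_coord: "a \<in> carrier A \<Longrightarrow> s a = coord \<one>\<^bsub>\<Gamma>\<^esub> a"
  by (simp add: coord_def)

lemma coord_mult:
  "\<lbrakk>g \<in> carrier \<Gamma>; h \<in> carrier \<Gamma>; a \<in> carrier A; b \<in> carrier A\<rbrakk> \<Longrightarrow>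
   coord g a \<otimes>\<^bsub>E\<^esub> coord h b = coord (g \<otimes>\<^bsub>\<Gamma>\<^esub> h) (a \<otimes>\<^bsub>A\<^esub> b)"
  by (simp add: coord_def E.m_ac)

text \<open>The projection reads off the second coordinate; cancelling the section value then leaves
  injectivity of \<open>\<iota>\<close>.\<close>

lemma coord_eq_iff:
  assumes "g \<in> carrier \<Gamma>" "h \<in> carrier \<Gamma>" "a \<in> carrier A" "b \<in> carrier A"
  shows "coord g a = coord h b \<longleftrightarrow> g = h \<and> a = b"
proof
  assume eq: "coord g a = coord h b"
  then have "a = b"
    using assms by (metis \<pi>_coord)
  with eq assms show "g = h \<and> a = b"
    by (simp add: coord_def \<iota>_inj)
qed simp

lemma coord_exists:
  assumes x: "x \<in> carrier E"
  obtains g where "g \<in> carrier \<Gamma>" "x = coord g (\<pi> x)"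
proof -
  \<comment> \<open>This is x - s(\<pi> x), with the negative placed inside \<open>s\<close>. It
    lies in the kernel of \<open>\<pi>\<close>, so exactness provides the first coordinate of
    \<open>x\<close>.\<close>
  let ?y = "x \<otimes>\<^bsub>E\<^esub> s (inv\<^bsub>A\<^esub> (\<pi> x))"
  have "?y \<in> carrier E" "\<pi> ?y = \<one>\<^bsub>A\<^esub>"
    using x by simp_all
  then obtain g where g: "g \<in> carrier \<Gamma>" "?y = \<iota> g"
    by (rule kernel_\<pi>)
  have "coord g (\<pi> x) = x \<otimes>\<^bsub>E\<^esub> (s (inv\<^bsub>A\<^esub> (\<pi> x)) \<otimes>\<^bsub>E\<^esub> s (\<pi> x))"
    using x by (simp add: coord_def E.m_assoc flip: g(2))
  also have "\<dots> = x"
    using x by (simp flip: hom_mult[OF s_hom])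
  finally show thesis
    using g that by metis
qed

lemma coord_bij: "bij_betw (\<lambda>(g, a). coord g a) (carrier \<Gamma> \<times> carrier A) (carrier E)"
proof (rule bij_betwI')
  fix x assume "x \<in> carrier E"
  moreover then obtain g where "g \<in> carrier \<Gamma>" "x = coord g (\<pi> x)"
    by (rule coord_exists)
  ultimately show "\<exists>p\<in>carrier \<Gamma> \<times> carrier A. x = (case p of (g, a) \<Rightarrow> coord g a)"
    by (intro bexI[of _ "(g, \<pi> x)"]) simp_all
qed (auto simp: coord_eq_iff)

text \<open>By the left law, the summand \<open>\<iota> g\<close> in the left factor contributes
  only translations by \<open>\<iota> g\<close>, which are trivial. By right additivity,
  \<open>\<iota> h\<close> splits off and is fixed by every translation.\<close>

lemma coord_cyc_s:
  assumes "g \<in> carrier \<Gamma>" "h \<in> carrier \<Gamma>" "a \<in> carrier A" "b \<in> carrier A"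
  shows "coord g a \<cdot>\<^bsub>E\<^esub> coord h b = \<iota> h \<otimes>\<^bsub>E\<^esub> (s a \<cdot>\<^bsub>E\<^esub> s b)"
  using assms by (simp add: coord_def E.cyc_add_left E.cyc_add_right)

text \<open>Moving the subtracted term across turns the defining equation into a statement on
  coordinates: \<open>f (a, b)\<close> is the first coordinate of the product of \<open>s a\<close>
  and \<open>s b\<close>.\<close>

lemma section_cocycle_iff:
  "section_cocycle A \<Gamma> E \<iota> s f \<longleftrightarrow>
     f \<in> carrier A \<times> carrier A \<rightarrow>\<^sub>E carrier \<Gamma> \<and>
     (\<forall>a\<in>carrier A. \<forall>b\<in>carrier A. s a \<cdot>\<^bsub>E\<^esub> s b = coord (f (a, b)) (a \<cdot>\<^bsub>A\<^esub> b))"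
proof -
  have "\<iota> (f (a, b)) = (s a \<cdot>\<^bsub>E\<^esub> s b) \<otimes>\<^bsub>E\<^esub> inv\<^bsub>E\<^esub> (s (a \<cdot>\<^bsub>A\<^esub> b)) \<longleftrightarrow>
      s a \<cdot>\<^bsub>E\<^esub> s b = coord (f (a, b)) (a \<cdot>\<^bsub>A\<^esub> b)"
    if "f \<in> carrier A \<times> carrier A \<rightarrow>\<^sub>E carrier \<Gamma>" "a \<in> carrier A" "b \<in> carrier A" for a b
  proof -
    have "f (a, b) \<in> carrier \<Gamma>" using that by auto
    then show ?thesis
      using that E.inv_solve_right[of "\<iota> (f (a, b))" "s a \<cdot>\<^bsub>E\<^esub> s b" "s (a \<cdot>\<^bsub>A\<^esub> b)"]
      by (auto simp: coord_def)
  qed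
  then show ?thesis
    unfolding section_cocycle_def by blast
qed

text \<open>The product of \<open>s a\<close> and \<open>s b\<close> projects to
  \<open>a \<cdot> b\<close>, so it has coordinates over that element, and these are unique.\<close>

lemma section_cocycle_ex1: "\<exists>!f. section_cocycle A \<Gamma> E \<iota> s f"
proof -
  have "\<forall>p\<in>carrier A \<times> carrier A. \<exists>g\<in>carrier \<Gamma>.
      s (fst p) \<cdot>\<^bsub>E\<^esub> s (snd p) = coord g (fst p \<cdot>\<^bsub>A\<^esub> snd p)"
  proof
    fix p assume "p \<in> carrier A \<times> carrier A"
    then have p: "fst p \<in> carrier A" "snd p \<in> carrier A" by auto
    then have "s (fst p) \<cdot>\<^bsub>E\<^esub> s (snd p) \<in> carrier E" by simp
    then obtain g where "g \<in> carrier \<Gamma>"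
      "s (fst p) \<cdot>\<^bsub>E\<^esub> s (snd p) = coord g (\<pi> (s (fst p) \<cdot>\<^bsub>E\<^esub> s (snd p)))"
      by (rule coord_exists)
    with p show "\<exists>g\<in>carrier \<Gamma>. s (fst p) \<cdot>\<^bsub>E\<^esub> s (snd p) = coord g (fst p \<cdot>\<^bsub>A\<^esub> snd p)"
      by auto
  qed
  from this[unfolded Bex_def, THEN bchoice] obtain f where
    f: "\<forall>p\<in>carrier A \<times> carrier A. f p \<in> carrier \<Gamma> \<and>
      s (fst p) \<cdot>\<^bsub>E\<^esub> s (snd p) = coord (f p) (fst p \<cdot>\<^bsub>A\<^esub> snd p)"
    by blast
  show ?thesis
  proof (rule ex1I)
    \<comment> \<open>The chosen function is arbitrary outside the product of carriers. Restricting
      makes it extensional, which is what allows uniqueness as an equality of functions.\<close>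
    show "section_cocycle A \<Gamma> E \<iota> s (restrict f (carrier A \<times> carrier A))"
      using f by (auto simp: section_cocycle_iff)
    fix f' assume f': "section_cocycle A \<Gamma> E \<iota> s f'"
    show "f' = restrict f (carrier A \<times> carrier A)"
    proof (rule extensional_pair_eqI)
      show "f' \<in> carrier A \<times> carrier A \<rightarrow>\<^sub>E carrier \<Gamma>"
        using f' by (simp add: section_cocycle_iff)
      show "restrict f (carrier A \<times> carrier A) \<in> carrier A \<times> carrier A \<rightarrow>\<^sub>E carrier \<Gamma>"
        using f by auto
      fix a b assume ab: "a \<in> carrier A" "b \<in> carrier A"
      then have "f' (a, b) \<in> carrier \<Gamma>" "f (a, b) \<in> carrier \<Gamma>"
        "coord (f' (a, b)) (a \<cdot>\<^bsub>A\<^esub> b) = coord (f (a, b)) (a \<cdot>\<^bsub>A\<^esub> b)"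
        using f f' by (force simp: section_cocycle_iff)+
      with ab show "f' (a, b) = restrict f (carrier A \<times> carrier A) (a, b)"
        by (simp add: coord_eq_iff)
    qed
  qed
qed

end

section \<open>The cocycle attached to a section\<close>

locale extension_with_cocycle = extension_with_section +
  fixes f
  assumes cocycle: "section_cocycle A \<Gamma> E \<iota> s f"
begin

lemma f_closed [simp]: "\<lbrakk>a \<in> carrier A; b \<in> carrier A\<rbrakk> \<Longrightarrow> f (a, b) \<in> carrier \<Gamma>"
  using cocycle by (auto simp: section_cocycle_iff)

lemma coord_cyc:
  assumes "g \<in> carrier \<Gamma>" "h \<in> carrier \<Gamma>" "a \<in> carrier A" "b \<in> carrier A"
  shows "coord g a \<cdot>\<^bsub>E\<^esub> coord h b = coord (h \<otimes>\<^bsub>\<Gamma>\<^esub> f (a, b)) (a \<cdot>\<^bsub>A\<^esub> b)"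
proof -
  have "coord g a \<cdot>\<^bsub>E\<^esub> coord h b = \<iota> h \<otimes>\<^bsub>E\<^esub> coord (f (a, b)) (a \<cdot>\<^bsub>A\<^esub> b)"
    using cocycle assms by (simp add: coord_cyc_s section_cocycle_iff)
  with assms show ?thesis
    by (simp add: \<iota>_eq_coord coord_mult)
qed

text \<open>The two linearity laws of \<open>E\<close>, applied to three values of the section, give
  the two cocycle equations when first coordinates are compared.\<close>

lemma cocycle_RZ2: "f \<in> carrier (RZ2 A \<Gamma>)"
proof (rule RZ2_memI)
  show "f \<in> carrier A \<times> carrier A \<rightarrow>\<^sub>E carrier \<Gamma>"
    using cocycle by (simp add: section_cocycle_iff)
  fix a b c assume [simp]: "a \<in> carrier A" "b \<in> carrier A" "c \<in> carrier A"
  show "f (a, b \<otimes>\<^bsub>A\<^esub> c) = f (a, b) \<otimes>\<^bsub>\<Gamma>\<^esub> f (a, c)"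
    using E.cyc_add_right[of "s a" "s b" "s c"]
    by (simp add: s_eq_coord coord_mult coord_cyc coord_eq_iff)
  show "f (a \<otimes>\<^bsub>A\<^esub> b, c) = f (a \<cdot>\<^bsub>A\<^esub> b, a \<cdot>\<^bsub>A\<^esub> c) \<otimes>\<^bsub>\<Gamma>\<^esub> f (a, c)"
    using E.cyc_add_left[of "s a" "s b" "s c"]
    by (simp add: s_eq_coord coord_mult coord_cyc coord_eq_iff \<Gamma>.m_comm)
qed

end

section \<open>The model extension built from a cocycle\<close>

definition cocycle_lcs ::
  "('a, 'r) lcs_scheme \<Rightarrow> ('g, 'q) monoid_scheme \<Rightarrow> ('a \<times> 'a \<Rightarrow> 'g) \<Rightarrow> ('g \<times> 'a) lcs" where
  "cocycle_lcs A \<Gamma> f =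
     \<lparr>carrier = carrier \<Gamma> \<times> carrier A,
      mult = (\<lambda>(g, a) (h, b). (g \<otimes>\<^bsub>\<Gamma>\<^esub> h, a \<otimes>\<^bsub>A\<^esub> b)),
      one = (\<one>\<^bsub>\<Gamma>\<^esub>, \<one>\<^bsub>A\<^esub>),
      cyc = (\<lambda>(g, a) (h, b). (h \<otimes>\<^bsub>\<Gamma>\<^esub> f (a, b), a \<cdot>\<^bsub>A\<^esub> b))\<rparr>"

context lcs_coefficients
begin

definition cocycle_incl :: "'g \<Rightarrow> 'g \<times> 'a" where
  "cocycle_incl g = (g, \<one>\<^bsub>A\<^esub>)"

text \<open>Addition in \<open>cocycle_lcs\<close> is componentwise and only the cycle operation is
  twisted by \<open>f\<close>, so the same map is an additive section of \<open>snd\<close> for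
  every cocycle.\<close>

definition cocycle_section :: "'a \<Rightarrow> 'g \<times> 'a" where
  "cocycle_section a = (\<one>\<^bsub>\<Gamma>\<^esub>, a)"

context
  fixes f assumes f: "f \<in> carrier (RZ2 A \<Gamma>)"
begin

lemma cocycle_lcs_comm_group: "comm_group (cocycle_lcs A \<Gamma> f)"
proof (rule comm_groupI)
  fix x assume "x \<in> carrier (cocycle_lcs A \<Gamma> f)"
  then show "\<exists>y\<in>carrier (cocycle_lcs A \<Gamma> f). y \<otimes>\<^bsub>cocycle_lcs A \<Gamma> f\<^esub> x = \<one>\<^bsub>cocycle_lcs A \<Gamma> f\<^esub>"
    by (intro bexI[of _ "(inv\<^bsub>\<Gamma>\<^esub> (fst x), inv\<^bsub>A\<^esub> (snd x))"]) (auto simp: cocycle_lcs_def)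
qed (auto simp: cocycle_lcs_def \<Gamma>.m_ac A.m_ac)

text \<open>In the second coordinate the two laws are those of \<open>A\<close>; in the first they
  are the cocycle equations. \<open>linear_cycle_setI\<close> derives the cycle set identity, which
  leaves bijectivity of translations.\<close>

lemma linear_cycle_set_cocycle_lcs: "linear_cycle_set (cocycle_lcs A \<Gamma> f)"
proof (rule linear_cycle_setI[OF cocycle_lcs_comm_group])
  note [simp] = RZ2_closed[OF f]
  fix x assume "x \<in> carrier (cocycle_lcs A \<Gamma> f)"
  then obtain g a where x: "x = (g, a)" and [simp]: "g \<in> carrier \<Gamma>" "a \<in> carrier A"
    by (auto simp: cocycle_lcs_def)
  show "bij_betw ((\<cdot>\<^bsub>cocycle_lcs A \<Gamma> f\<^esub>) x) (carrier (cocycle_lcs A \<Gamma> f)) (carrier (cocycle_lcs A \<Gamma> f))"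
  proof (rule bij_betwI')
    fix z assume "z \<in> carrier (cocycle_lcs A \<Gamma> f)"
    then obtain k c where z: "z = (k, c)" and [simp]: "k \<in> carrier \<Gamma>" "c \<in> carrier A"
      by (auto simp: cocycle_lcs_def)
    \<comment> \<open>The second coordinate is solved first, because the correction
      \<open>f (a, b)\<close> to be subtracted in the first one depends on \<open>b\<close>.\<close>
    obtain b where [simp]: "b \<in> carrier A" "a \<cdot>\<^bsub>A\<^esub> b = c"
      by (rule A.cyc_surj[of a c]) auto
    show "\<exists>y\<in>carrier (cocycle_lcs A \<Gamma> f). z = x \<cdot>\<^bsub>cocycle_lcs A \<Gamma> f\<^esub> y"
      by (rule bexI[of _ "(k \<otimes>\<^bsub>\<Gamma>\<^esub> inv\<^bsub>\<Gamma>\<^esub> (f (a, b)), b)"])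
        (auto simp: cocycle_lcs_def x z \<Gamma>.m_assoc)
  qed (auto simp: cocycle_lcs_def x A.cyc_inj)
qed (auto simp: cocycle_lcs_def A.cyc_add_left A.cyc_add_right RZ2_closed[OF f]
    RZ2_add_left[OF f] RZ2_add_right[OF f] \<Gamma>.m_ac)

text \<open>A cocycle vanishes as soon as one argument is \<open>\<one>\<close>, so the twist
  disappears on the copy of \<open>\<Gamma>\<close>. Hence the inclusion respects the trivial cycle
  structure and its image is central.\<close>

lemma cocycle_lcs_extension:
  "central_ct_extension A \<Gamma> (cocycle_lcs A \<Gamma> f) cocycle_incl snd"
proof -
  interpret E: linear_cycle_set "cocycle_lcs A \<Gamma> f"
    by (rule linear_cycle_set_cocycle_lcs)
  have exact: "lcs_short_exact (trivial_lcs \<Gamma>) (cocycle_lcs A \<Gamma> f) A cocycle_incl snd"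
    unfolding lcs_short_exact_def
    using linear_cycle_set_trivial_lcs[OF \<Gamma>.comm_group_axioms]
      E.linear_cycle_set_axioms A.linear_cycle_set_axioms f
    by (auto simp: lcs_hom_def hom_def trivial_lcs_def cocycle_lcs_def kernel_def inj_on_def
        image_iff cocycle_incl_def)
  \<comment> \<open>Centrality includes that the image is a linear cycle set under the restricted
    operations, which is checked separately.\<close>
  let ?I = "cocycle_incl ` carrier \<Gamma>"
  let ?EI = "cocycle_lcs A \<Gamma> f\<lparr>carrier := ?I\<rparr>"
  have "comm_group ?EI"
  proof (rule comm_groupI)
    fix x assume "x \<in> carrier ?EI"
    then show "\<exists>y\<in>carrier ?EI. y \<otimes>\<^bsub>?EI\<^esub> x = \<one>\<^bsub>?EI\<^esub>"
      by (intro bexI[of _ "(inv\<^bsub>\<Gamma>\<^esub> (fst x), \<one>\<^bsub>A\<^esub>)"]) (auto simp: cocycle_lcs_def cocycle_incl_def)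
  qed (auto simp: cocycle_lcs_def cocycle_incl_def \<Gamma>.m_ac)
  then have "linear_cycle_set ?EI"
    using f by (intro linear_cycle_setI)
      (auto simp: cocycle_lcs_def cocycle_incl_def bij_betw_def inj_on_def image_iff)
  then have central: "central_lcs_subset ?I (cocycle_lcs A \<Gamma> f)"
    unfolding central_lcs_subset_def linear_cycle_subset_def
    using f by (auto simp: cocycle_lcs_def cocycle_incl_def)
  have "cocycle_section \<in> additive_sections A (cocycle_lcs A \<Gamma> f) snd"
    by (auto simp: additive_sections_def hom_def cocycle_lcs_def cocycle_section_def)
  with exact central show ?thesis
    by (auto simp: central_ct_extension_def)
qed

lemma cocycle_lcs_with_section:
  "extension_with_section A \<Gamma> (cocycle_lcs A \<Gamma> f) cocycle_incl snd cocycle_section"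
proof unfold_locales
  show "central_ct_extension A \<Gamma> (cocycle_lcs A \<Gamma> f) cocycle_incl snd"
    by (rule cocycle_lcs_extension)
  show "cocycle_section \<in> additive_sections A (cocycle_lcs A \<Gamma> f) snd"
    by (auto simp: additive_sections_def hom_def cocycle_lcs_def cocycle_section_def)
qed

text \<open>The canonical section recovers \<open>f\<close> itself, not merely its coset.
  Surjectivity of the correspondence rests on this.\<close>

lemma cocycle_lcs_with_cocycle:
  "extension_with_cocycle A \<Gamma> (cocycle_lcs A \<Gamma> f) cocycle_incl snd cocycle_section f"
proof -
  interpret extension_with_section A \<Gamma> "cocycle_lcs A \<Gamma> f" cocycle_incl snd cocycle_section
    by (rule cocycle_lcs_with_section)
  have "f \<in> carrier A \<times> carrier A \<rightarrow>\<^sub>E carrier \<Gamma>"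
    using f by (simp add: RZ2_def)
  moreover have "cocycle_section a \<cdot>\<^bsub>cocycle_lcs A \<Gamma> f\<^esub> cocycle_section b =
      coord (f (a, b)) (a \<cdot>\<^bsub>A\<^esub> b)" if "a \<in> carrier A" "b \<in> carrier A" for a b
    unfolding coord_def using that RZ2_closed[OF f that]
    by (simp add: cocycle_lcs_def cocycle_incl_def cocycle_section_def)
  ultimately have "section_cocycle A \<Gamma> (cocycle_lcs A \<Gamma> f) cocycle_incl cocycle_section f"
    by (simp add: section_cocycle_iff)
  then show ?thesis
    by unfold_locales
qed

end

end

section \<open>Equivalence of extensions\<close>

lemma equivalent_extensions_refl: "equivalent_extensions \<Gamma> E \<iota> \<pi> E \<iota> \<pi>"
  unfolding equivalent_extensions_def
  by (rule bexI[of _ "\<lambda>x. x"]) (auto simp: lcs_iso_def lcs_hom_def hom_def bij_betw_def)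

lemma equivalent_extensions_trans:
  assumes "equivalent_extensions \<Gamma> E \<iota> \<pi> E' \<iota>' \<pi>'" "equivalent_extensions \<Gamma> E' \<iota>' \<pi>' E'' \<iota>'' \<pi>''"
  shows "equivalent_extensions \<Gamma> E \<iota> \<pi> E'' \<iota>'' \<pi>''"
proof -
  obtain \<phi> \<psi> where "\<phi> \<in> lcs_iso E E'" "\<forall>\<gamma>\<in>carrier \<Gamma>. \<phi> (\<iota> \<gamma>) = \<iota>' \<gamma>" "\<forall>e\<in>carrier E. \<pi>' (\<phi> e) = \<pi> e"
    "\<psi> \<in> lcs_iso E' E''" "\<forall>\<gamma>\<in>carrier \<Gamma>. \<psi> (\<iota>' \<gamma>) = \<iota>'' \<gamma>" "\<forall>e\<in>carrier E'. \<pi>'' (\<psi> e) = \<pi>' e"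
    using assms unfolding equivalent_extensions_def by blast
  then show ?thesis
    unfolding equivalent_extensions_def
    by (intro bexI[of _ "\<psi> \<circ> \<phi>"])
      (auto simp: lcs_iso_def lcs_hom_def hom_def Pi_iff intro: bij_betw_trans)
qed

text \<open>The inverse bijection inherits all compatibilities. The hypothesis on \<open>E\<close>
  provides closure under both operations and places the image of \<open>\<iota>\<close> in the
  carrier, so that the inverse can be cancelled there.\<close>

lemma equivalent_extensions_sym:
  assumes ext: "central_ct_extension A \<Gamma> E \<iota> \<pi>"
    and "equivalent_extensions \<Gamma> E \<iota> \<pi> E' \<iota>' \<pi>'"
  shows "equivalent_extensions \<Gamma> E' \<iota>' \<pi>' E \<iota> \<pi>"
proof -
  interpret E: linear_cycle_set E
    using ext by (simp add: central_ct_extension_def lcs_short_exact_def)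
  obtain \<phi> where \<phi>: "\<phi> \<in> lcs_iso E E'" "\<forall>\<gamma>\<in>carrier \<Gamma>. \<phi> (\<iota> \<gamma>) = \<iota>' \<gamma>" "\<forall>e\<in>carrier E. \<pi>' (\<phi> e) = \<pi> e"
    using assms unfolding equivalent_extensions_def by blast
  have \<iota>: "\<iota> \<gamma> \<in> carrier E" if "\<gamma> \<in> carrier \<Gamma>" for \<gamma>
    using ext that by (auto simp: central_ct_extension_def lcs_short_exact_def lcs_hom_def hom_def
        trivial_lcs_def)
  have bij: "bij_betw \<phi> (carrier E) (carrier E')"
    and hom: "\<And>x y. \<lbrakk>x \<in> carrier E; y \<in> carrier E\<rbrakk> \<Longrightarrow> \<phi> (x \<otimes>\<^bsub>E\<^esub> y) = \<phi> x \<otimes>\<^bsub>E'\<^esub> \<phi> y"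
      "\<And>x y. \<lbrakk>x \<in> carrier E; y \<in> carrier E\<rbrakk> \<Longrightarrow> \<phi> (x \<cdot>\<^bsub>E\<^esub> y) = \<phi> x \<cdot>\<^bsub>E'\<^esub> \<phi> y"
    using \<phi>(1) by (auto simp: lcs_iso_def lcs_hom_def hom_def)
  define \<psi> where "\<psi> = inv_into (carrier E) \<phi>"
  have left: "\<psi> (\<phi> x) = x" if "x \<in> carrier E" for x
    using bij that by (simp add: \<psi>_def bij_betw_def)
  have surj: "\<exists>x\<in>carrier E. y = \<phi> x" if "y \<in> carrier E'" for y
    using bij that by (auto simp: bij_betw_def)
  have "\<psi> \<in> hom E' E"
    by (auto simp: hom_def left simp flip: hom dest!: surj)
  moreover have "\<psi> (y \<cdot>\<^bsub>E'\<^esub> y') = \<psi> y \<cdot>\<^bsub>E\<^esub> \<psi> y'" if "y \<in> carrier E'" "y' \<in> carrier E'" for y y'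
    using that by (auto simp: left simp flip: hom dest!: surj)
  moreover have "bij_betw \<psi> (carrier E') (carrier E)"
    unfolding \<psi>_def using bij by (rule bij_betw_inv_into)
  ultimately have "\<psi> \<in> lcs_iso E' E"
    by (auto simp: lcs_iso_def lcs_hom_def)
  moreover have "\<psi> (\<iota>' \<gamma>) = \<iota> \<gamma>" if "\<gamma> \<in> carrier \<Gamma>" for \<gamma>
    using left[OF \<iota>[OF that]] \<phi>(2) that by simp
  moreover have "\<pi> (\<psi> y) = \<pi>' y" if "y \<in> carrier E'" for y
    using surj[OF that] \<phi>(3) left by auto
  ultimately show ?thesis
    unfolding equivalent_extensions_def by blast
qed

text \<open>Extensions are compared through models. Allowing any representative \<open>f'\<close> of
  the coset covers both the model of the extension's own cocycle and the model of a cohomologous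
  one.\<close>

lemma (in extension_with_cocycle) equivalent_cocycle_lcs:
  assumes f': "f' \<in> carrier (RZ2 A \<Gamma>)"
    and coset: "RB2 A \<Gamma> #>\<^bsub>RZ2 A \<Gamma>\<^esub> f' = RB2 A \<Gamma> #>\<^bsub>RZ2 A \<Gamma>\<^esub> f"
  shows "equivalent_extensions \<Gamma> (cocycle_lcs A \<Gamma> f') cocycle_incl snd E \<iota> \<pi>"
proof -
  obtain \<theta> where \<theta>: "\<theta> \<in> hom A \<Gamma>" and eq: "\<And>a b. \<lbrakk>a \<in> carrier A; b \<in> carrier A\<rbrakk> \<Longrightarrow>
      f (a, b) \<otimes>\<^bsub>\<Gamma>\<^esub> \<theta> b = f' (a, b) \<otimes>\<^bsub>\<Gamma>\<^esub> \<theta> (a \<cdot>\<^bsub>A\<^esub> b)"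
    using coset RB2_coset_eq_iff[OF f' cocycle_RZ2] by auto
  note [simp] = hom_in_carrier[OF \<theta>] hom_mult[OF \<theta>] hom_one[OF \<theta> A.is_group \<Gamma>.is_group] RZ2_closed[OF f']
  \<comment> \<open>The shift by \<open>\<theta> a\<close> is the one for which \<open>eq\<close>
    trades the twist \<open>f'\<close> of the model for the twist \<open>f\<close> of
    \<open>E\<close>.\<close>
  let ?\<phi> = "\<lambda>(g, a). coord (g \<otimes>\<^bsub>\<Gamma>\<^esub> \<theta> a) a"
  have cyc: "?\<phi> (x \<cdot>\<^bsub>cocycle_lcs A \<Gamma> f'\<^esub> y) = ?\<phi> x \<cdot>\<^bsub>E\<^esub> ?\<phi> y"
    if xE: "x \<in> carrier (cocycle_lcs A \<Gamma> f')" and yE: "y \<in> carrier (cocycle_lcs A \<Gamma> f')" for x y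
  proof -
    obtain g a where x: "x = (g, a)" and [simp]: "g \<in> carrier \<Gamma>" "a \<in> carrier A"
      using xE by (auto simp: cocycle_lcs_def)
    obtain h b where y: "y = (h, b)" and [simp]: "h \<in> carrier \<Gamma>" "b \<in> carrier A"
      using yE by (auto simp: cocycle_lcs_def)
    have "?\<phi> (x \<cdot>\<^bsub>cocycle_lcs A \<Gamma> f'\<^esub> y) = coord (h \<otimes>\<^bsub>\<Gamma>\<^esub> (f' (a, b) \<otimes>\<^bsub>\<Gamma>\<^esub> \<theta> (a \<cdot>\<^bsub>A\<^esub> b))) (a \<cdot>\<^bsub>A\<^esub> b)"
      by (simp add: x y cocycle_lcs_def \<Gamma>.m_assoc)
    also have "\<dots> = coord (h \<otimes>\<^bsub>\<Gamma>\<^esub> \<theta> b \<otimes>\<^bsub>\<Gamma>\<^esub> f (a, b)) (a \<cdot>\<^bsub>A\<^esub> b)"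
      by (simp add: \<Gamma>.m_ac flip: eq)
    also have "\<dots> = ?\<phi> x \<cdot>\<^bsub>E\<^esub> ?\<phi> y"
      by (simp add: x y coord_cyc)
    finally show ?thesis .
  qed
  \<comment> \<open>The map is a shear of the product, inverted by the shear along the negative of
    \<open>\<theta>\<close>, followed by the coordinate bijection.\<close>
  have "bij_betw (\<lambda>(g, a). (g \<otimes>\<^bsub>\<Gamma>\<^esub> \<theta> a, a)) (carrier \<Gamma> \<times> carrier A) (carrier \<Gamma> \<times> carrier A)"
    by (rule bij_betw_byWitness[where f' = "\<lambda>(g, a). (g \<otimes>\<^bsub>\<Gamma>\<^esub> inv\<^bsub>\<Gamma>\<^esub> (\<theta> a), a)"])
      (auto simp: \<Gamma>.m_assoc)
  from bij_betw_trans[OF this coord_bij]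
  have "bij_betw ?\<phi> (carrier (cocycle_lcs A \<Gamma> f')) (carrier E)"
    by (simp add: cocycle_lcs_def comp_def case_prod_unfold)
  moreover have "?\<phi> \<in> hom (cocycle_lcs A \<Gamma> f') E"
    by (auto simp: hom_def cocycle_lcs_def coord_mult \<Gamma>.m_ac)
  ultimately have "?\<phi> \<in> lcs_iso (cocycle_lcs A \<Gamma> f') E"
    using cyc by (simp add: lcs_iso_def lcs_hom_def)
  then show ?thesis
    unfolding equivalent_extensions_def
    by (rule bexI[rotated]) (auto simp: cocycle_lcs_def cocycle_incl_def \<iota>_eq_coord)
qed

section \<open>Comparison of two extensions through their cocycles\<close>

locale two_extensions_with_cocycles =
  E1: extension_with_cocycle A \<Gamma> E \<iota> \<pi> s f + E2: extension_with_cocycle A \<Gamma> E' \<iota>' \<pi>' s' f'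
  for A :: "('a, 'r) lcs_scheme" and \<Gamma> :: "('g, 'q) monoid_scheme"
    and E :: "'e lcs" and \<iota> \<pi> s f and E' :: "'f lcs" and \<iota>' \<pi>' s' f'
begin

text \<open>The comparison map \<open>\<theta>\<close> is the \<open>\<Gamma>\<close>-coordinate of \<open>\<phi> \<circ> s\<close> with respect to \<open>s'\<close>.\<close>

lemma coset_eq_if_equivalent:
  assumes "equivalent_extensions \<Gamma> E \<iota> \<pi> E' \<iota>' \<pi>'"
  shows "RB2 A \<Gamma> #>\<^bsub>RZ2 A \<Gamma>\<^esub> f = RB2 A \<Gamma> #>\<^bsub>RZ2 A \<Gamma>\<^esub> f'"
proof -
  obtain \<phi> where "\<phi> \<in> lcs_iso E E'" and \<phi>_\<iota>: "\<And>\<gamma>. \<gamma> \<in> carrier \<Gamma> \<Longrightarrow> \<phi> (\<iota> \<gamma>) = \<iota>' \<gamma>"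
    and \<phi>_\<pi>: "\<And>e. e \<in> carrier E \<Longrightarrow> \<pi>' (\<phi> e) = \<pi> e"
    using assms unfolding equivalent_extensions_def by blast
  then have \<phi>_hom: "\<phi> \<in> hom E E'"
    and \<phi>_cyc: "\<And>x y. \<lbrakk>x \<in> carrier E; y \<in> carrier E\<rbrakk> \<Longrightarrow> \<phi> (x \<cdot>\<^bsub>E\<^esub> y) = \<phi> x \<cdot>\<^bsub>E'\<^esub> \<phi> y"
    by (auto simp: lcs_iso_def lcs_hom_def)
  note [simp] = hom_in_carrier[OF \<phi>_hom]
  have "\<forall>a\<in>carrier A. \<exists>g\<in>carrier \<Gamma>. \<phi> (s a) = E2.coord g a"
  proof
    fix a assume a: "a \<in> carrier A"
    then have "\<phi> (s a) \<in> carrier E'" by simp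
    then obtain g where "g \<in> carrier \<Gamma>" "\<phi> (s a) = E2.coord g (\<pi>' (\<phi> (s a)))"
      by (rule E2.coord_exists)
    with a show "\<exists>g\<in>carrier \<Gamma>. \<phi> (s a) = E2.coord g a"
      by (auto simp: \<phi>_\<pi>)
  qed
  from this[unfolded Bex_def, THEN bchoice] obtain \<theta> where
    \<theta> [simp]: "\<And>a. a \<in> carrier A \<Longrightarrow> \<theta> a \<in> carrier \<Gamma>"
    and \<phi>_s: "\<And>a. a \<in> carrier A \<Longrightarrow> \<phi> (s a) = E2.coord (\<theta> a) a"
    by blast
  \<comment> \<open>An additive map on \<open>E\<close> is determined by its values on
    \<open>\<iota>\<close> and \<open>s\<close>, so \<open>\<phi>\<close> has to be a shear in
    coordinates.\<close>
  have \<phi>_coord: "\<phi> (E1.coord g a) = E2.coord (g \<otimes>\<^bsub>\<Gamma>\<^esub> \<theta> a) a"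
    if "g \<in> carrier \<Gamma>" "a \<in> carrier A" for g a
  proof -
    have "\<phi> (E1.coord g a) = \<iota>' g \<otimes>\<^bsub>E'\<^esub> E2.coord (\<theta> a) a"
      using that by (simp add: E1.coord_def hom_mult[OF \<phi>_hom] \<phi>_\<iota> \<phi>_s)
    with that show ?thesis
      by (simp add: E2.\<iota>_eq_coord E2.coord_mult)
  qed
  have "\<theta> \<in> hom A \<Gamma>"
  proof (rule homI)
    fix a b assume [simp]: "a \<in> carrier A" "b \<in> carrier A"
    have "E2.coord (\<theta> (a \<otimes>\<^bsub>A\<^esub> b)) (a \<otimes>\<^bsub>A\<^esub> b) = \<phi> (s a) \<otimes>\<^bsub>E'\<^esub> \<phi> (s b)"
      by (simp add: hom_mult[OF \<phi>_hom, symmetric] flip: \<phi>_s)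
    also have "\<dots> = E2.coord (\<theta> a \<otimes>\<^bsub>\<Gamma>\<^esub> \<theta> b) (a \<otimes>\<^bsub>A\<^esub> b)"
      by (simp add: \<phi>_s E2.coord_mult)
    finally show "\<theta> (a \<otimes>\<^bsub>A\<^esub> b) = \<theta> a \<otimes>\<^bsub>\<Gamma>\<^esub> \<theta> b"
      by (simp add: E2.coord_eq_iff)
  qed simp
  moreover have "f' (a, b) \<otimes>\<^bsub>\<Gamma>\<^esub> \<theta> b = f (a, b) \<otimes>\<^bsub>\<Gamma>\<^esub> \<theta> (a \<cdot>\<^bsub>A\<^esub> b)"
    if [simp]: "a \<in> carrier A" "b \<in> carrier A" for a b
  proof -
    \<comment> \<open>The same element is computed twice: the product is formed in \<open>E\<close>
      and then mapped, or the factors are mapped and multiplied in \<open>E'\<close>. Comparing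
      first coordinates gives the coset relation.\<close>
    have "E2.coord (f (a, b) \<otimes>\<^bsub>\<Gamma>\<^esub> \<theta> (a \<cdot>\<^bsub>A\<^esub> b)) (a \<cdot>\<^bsub>A\<^esub> b) = \<phi> (s a \<cdot>\<^bsub>E\<^esub> s b)"
      by (simp add: E1.s_eq_coord E1.coord_cyc \<phi>_coord)
    also have "\<dots> = E2.coord (\<theta> b \<otimes>\<^bsub>\<Gamma>\<^esub> f' (a, b)) (a \<cdot>\<^bsub>A\<^esub> b)"
      by (simp add: \<phi>_cyc \<phi>_s E2.coord_cyc)
    finally show ?thesis
      by (simp add: E2.coord_eq_iff E1.\<Gamma>.m_comm)
  qed
  ultimately show ?thesis
    using E1.RB2_coset_eq_iff[OF E1.cocycle_RZ2 E2.cocycle_RZ2] by blast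
qed

text \<open>If the cosets agree, the model of \<open>f\<close> is equivalent to both extensions, and
  symmetry and transitivity connect them.\<close>

lemma equivalent_iff_coset_eq:
  "equivalent_extensions \<Gamma> E \<iota> \<pi> E' \<iota>' \<pi>' \<longleftrightarrow>
   RB2 A \<Gamma> #>\<^bsub>RZ2 A \<Gamma>\<^esub> f = RB2 A \<Gamma> #>\<^bsub>RZ2 A \<Gamma>\<^esub> f'"
proof
  assume "RB2 A \<Gamma> #>\<^bsub>RZ2 A \<Gamma>\<^esub> f = RB2 A \<Gamma> #>\<^bsub>RZ2 A \<Gamma>\<^esub> f'"
  then have "equivalent_extensions \<Gamma> (cocycle_lcs A \<Gamma> f) E1.cocycle_incl snd E' \<iota>' \<pi>'"
    by (rule E2.equivalent_cocycle_lcs[OF E1.cocycle_RZ2])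
  moreover have "equivalent_extensions \<Gamma> E \<iota> \<pi> (cocycle_lcs A \<Gamma> f) E1.cocycle_incl snd"
    by (intro equivalent_extensions_sym[OF E1.cocycle_lcs_extension] E1.equivalent_cocycle_lcs
        E1.cocycle_RZ2 refl)
  ultimately show "equivalent_extensions \<Gamma> E \<iota> \<pi> E' \<iota>' \<pi>'"
    by (blast intro: equivalent_extensions_trans)
qed (rule coset_eq_if_equivalent)

end

section \<open>The cohomology class of an extension\<close>

lemma (in extension_with_cocycle) RH2_class_eq:
  "RH2_class A \<Gamma> E \<iota> \<pi> = RB2 A \<Gamma> #>\<^bsub>RZ2 A \<Gamma>\<^esub> f"
  unfolding RH2_class_def
proof (rule the_equality)
  show "\<exists>s\<in>additive_sections A E \<pi>. \<exists>f'. section_cocycle A \<Gamma> E \<iota> s f' \<and>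
      RB2 A \<Gamma> #>\<^bsub>RZ2 A \<Gamma>\<^esub> f = RB2 A \<Gamma> #>\<^bsub>RZ2 A \<Gamma>\<^esub> f'"
    using section_s cocycle by blast
next
  fix c assume "\<exists>s\<in>additive_sections A E \<pi>. \<exists>f'. section_cocycle A \<Gamma> E \<iota> s f' \<and>
    c = RB2 A \<Gamma> #>\<^bsub>RZ2 A \<Gamma>\<^esub> f'"
  then obtain s' f' where s': "s' \<in> additive_sections A E \<pi>" "section_cocycle A \<Gamma> E \<iota> s' f'"
    and c: "c = RB2 A \<Gamma> #>\<^bsub>RZ2 A \<Gamma>\<^esub> f'"
    by blast
  \<comment> \<open>The extension is compared with itself, first with the arbitrary section and then
    with the fixed one, so that reflexivity yields equal cosets and the description has a unique
    solution.\<close>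
  interpret two_extensions_with_cocycles A \<Gamma> E \<iota> \<pi> s' f' E \<iota> \<pi> s f
    using s' extension by unfold_locales
  show "c = RB2 A \<Gamma> #>\<^bsub>RZ2 A \<Gamma>\<^esub> f"
    unfolding c by (intro coset_eq_if_equivalent equivalent_extensions_refl)
qed

context lcs_coefficients
begin

lemma extension_cocycleE:
  assumes "central_ct_extension A \<Gamma> E \<iota> \<pi>"
  obtains s f where "extension_with_cocycle A \<Gamma> E \<iota> \<pi> s f"
proof -
  obtain s where s: "s \<in> additive_sections A E \<pi>"
    using assms by (auto simp: central_ct_extension_def)
  interpret extension_with_section A \<Gamma> E \<iota> \<pi> s
    using assms s by unfold_locales
  obtain f where "section_cocycle A \<Gamma> E \<iota> s f"
    using section_cocycle_ex1 by blast
  then have "extension_with_cocycle A \<Gamma> E \<iota> \<pi> s f"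
    by unfold_locales
  then show thesis by (rule that)
qed

lemma section_cocycle_class:
  assumes "central_ct_extension A \<Gamma> E \<iota> \<pi>" "s \<in> additive_sections A E \<pi>"
  shows "\<exists>!f. section_cocycle A \<Gamma> E \<iota> s f"
    and "section_cocycle A \<Gamma> E \<iota> s f \<Longrightarrow> f \<in> carrier (RZ2 A \<Gamma>)"
    and "section_cocycle A \<Gamma> E \<iota> s f \<Longrightarrow> RH2_class A \<Gamma> E \<iota> \<pi> = RB2 A \<Gamma> #>\<^bsub>RZ2 A \<Gamma>\<^esub> f"
proof -
  interpret extension_with_section A \<Gamma> E \<iota> \<pi> s
    using assms by unfold_locales
  show "\<exists>!f. section_cocycle A \<Gamma> E \<iota> s f"
    by (rule section_cocycle_ex1)
  assume "section_cocycle A \<Gamma> E \<iota> s f"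
  then interpret extension_with_cocycle A \<Gamma> E \<iota> \<pi> s f
    by unfold_locales
  show "f \<in> carrier (RZ2 A \<Gamma>)" "RH2_class A \<Gamma> E \<iota> \<pi> = RB2 A \<Gamma> #>\<^bsub>RZ2 A \<Gamma>\<^esub> f"
    by (rule cocycle_RZ2, rule RH2_class_eq)
qed

text \<open>One direction makes the class constant on equivalence classes, the other makes the
  induced map injective. The two carriers may live in different types.\<close>

lemma equivalent_iff_RH2_class_eq:
  assumes "central_ct_extension A \<Gamma> E \<iota> \<pi>" "central_ct_extension A \<Gamma> E' \<iota>' \<pi>'"
  shows "equivalent_extensions \<Gamma> E \<iota> \<pi> E' \<iota>' \<pi>' \<longleftrightarrow>
    RH2_class A \<Gamma> E \<iota> \<pi> = RH2_class A \<Gamma> E' \<iota>' \<pi>'"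
proof -
  obtain s f s' f' where 1: "extension_with_cocycle A \<Gamma> E \<iota> \<pi> s f"
    and 2: "extension_with_cocycle A \<Gamma> E' \<iota>' \<pi>' s' f'"
    using assms by (meson extension_cocycleE)
  interpret two_extensions_with_cocycles A \<Gamma> E \<iota> \<pi> s f E' \<iota>' \<pi>' s' f'
    by (rule two_extensions_with_cocycles.intro[OF 1 2])
  show ?thesis
    by (simp add: equivalent_iff_coset_eq E1.RH2_class_eq E2.RH2_class_eq)
qed

lemma RH2_class_closed:
  assumes "central_ct_extension A \<Gamma> E \<iota> \<pi>"
  shows "RH2_class A \<Gamma> E \<iota> \<pi> \<in> carrier (RH2 A \<Gamma>)"
proof -
  obtain s f where "extension_with_cocycle A \<Gamma> E \<iota> \<pi> s f"
    using assms by (rule extension_cocycleE)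
  then interpret extension_with_cocycle A \<Gamma> E \<iota> \<pi> s f .
  show ?thesis
    using cocycle_RZ2 by (auto simp: RH2_class_eq RH2_def carrier_FactGroup)
qed

text \<open>Any representative of \<open>c\<close> serves, since the canonical section of its model
  has that representative as cocycle.\<close>

lemma RH2_class_surj:
  assumes "c \<in> carrier (RH2 A \<Gamma>)"
  obtains f where "f \<in> carrier (RZ2 A \<Gamma>)"
    "RH2_class A \<Gamma> (cocycle_lcs A \<Gamma> f) cocycle_incl snd = c"
proof -
  obtain f where f: "f \<in> carrier (RZ2 A \<Gamma>)" "c = RB2 A \<Gamma> #>\<^bsub>RZ2 A \<Gamma>\<^esub> f"
    using assms by (auto simp: RH2_def carrier_FactGroup)
  interpret E: extension_with_cocycle A \<Gamma> "cocycle_lcs A \<Gamma> f" cocycle_incl snd cocycle_section f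
    using f(1) by (rule cocycle_lcs_with_cocycle)
  show thesis
    using that f E.RH2_class_eq by simp
qed

text \<open>The extension and the model of a representative of its class have equal classes. This
  transfers an extension on any type to one on pairs.\<close>

lemma equivalent_to_cocycle_lcs:
  assumes ext: "central_ct_extension A \<Gamma> E \<iota> \<pi>"
  obtains f where "f \<in> carrier (RZ2 A \<Gamma>)"
    "equivalent_extensions \<Gamma> E \<iota> \<pi> (cocycle_lcs A \<Gamma> f) cocycle_incl snd"
  using RH2_class_surj[OF RH2_class_closed[OF ext]]
    equivalent_iff_RH2_class_eq[OF ext cocycle_lcs_extension] by metis

text \<open>Equivalence is the kernel relation of the class map, which reduces the correspondence to
  a general fact on quotients by such relations.\<close>

lemma CTExt_eq_quotient_kernel:
  "CTExt A \<Gamma> = {(E, \<iota>, \<pi>). central_ct_extension A \<Gamma> E \<iota> \<pi>} //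
     {(X, X'). X \<in> {(E, \<iota>, \<pi>). central_ct_extension A \<Gamma> E \<iota> \<pi>} \<and>
               X' \<in> {(E, \<iota>, \<pi>). central_ct_extension A \<Gamma> E \<iota> \<pi>} \<and>
               (case X of (E, \<iota>, \<pi>) \<Rightarrow> RH2_class A \<Gamma> E \<iota> \<pi>) =
               (case X' of (E, \<iota>, \<pi>) \<Rightarrow> RH2_class A \<Gamma> E \<iota> \<pi>)}"
  unfolding CTExt_def
  by (rule arg_cong[where f = "(//) _"]) (auto simp: equivalent_iff_RH2_class_eq)

end

section \<open>Quotients by the kernel relation of a map\<close>

lemma the_elem_image_kernel_class:
  assumes "C \<in> S // {(x, y). x \<in> S \<and> y \<in> S \<and> F x = F y}" and "x \<in> C"
  shows "the_elem (F ` C) = F x"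
proof -
  have "F ` C = {F x}"
    using assms by (auto simp: quotient_def)
  then show ?thesis by simp
qed

text \<open>The factorisation of a map through its kernel relation. On each class \<open>F\<close>
  takes a single value, which \<open>the_elem\<close> extracts just as in
  \<open>CTExt_to_RH2\<close>.\<close>

lemma bij_betw_quotient_kernel:
  "bij_betw (\<lambda>C. the_elem (F ` C)) (S // {(x, y). x \<in> S \<and> y \<in> S \<and> F x = F y}) (F ` S)"
    (is "bij_betw ?G (S // ?r) _")
proof -
  have eq: "?r `` {x} = {y \<in> S. F x = F y}" if "x \<in> S" for x
    using that by auto
  have G: "?G (?r `` {x}) = F x" if "x \<in> S" for x
    using that by (intro the_elem_image_kernel_class[where S = S]) (auto simp: quotient_def)
  show ?thesis
    unfolding bij_betw_def
  proof
    show "inj_on ?G (S // ?r)"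
    proof (rule inj_onI)
      fix C D assume "C \<in> S // ?r" "D \<in> S // ?r" and GCD: "?G C = ?G D"
      then obtain x y where xy: "x \<in> S" "y \<in> S" "C = ?r `` {x}" "D = ?r `` {y}"
        by (auto simp: quotient_def)
      have "F x = ?G C" unfolding xy(3) by (rule G[OF xy(1), symmetric])
      also have "\<dots> = F y" unfolding GCD xy(4) by (rule G[OF xy(2)])
      finally show "C = D" unfolding xy(3,4) eq[OF xy(1)] eq[OF xy(2)] by simp
    qed
    have "S // ?r = (\<lambda>x. ?r `` {x}) ` S"
      by (auto simp: quotient_def)
    then have "?G ` (S // ?r) = (\<lambda>x. ?G (?r `` {x})) ` S"
      by (simp only: image_image)
    also have "\<dots> = F ` S"
      by (rule image_cong[OF refl G])
    finally show "?G ` (S // ?r) = F ` S" .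
  qed
qed

section \<open>Assembly of the correspondence\<close>

theorem theorem3p11:
  fixes A :: "('a, 'r) lcs_scheme" and \<Gamma> :: "('g, 'q) monoid_scheme"
  assumes "linear_cycle_set A" and "comm_group \<Gamma>"
  shows
    "(\<forall>(E :: 'e lcs) \<iota> \<pi>. central_ct_extension A \<Gamma> E \<iota> \<pi> \<longrightarrow>
        additive_sections A E \<pi> \<noteq> {} \<and>
        (\<forall>s\<in>additive_sections A E \<pi>.
           (\<exists>!f. section_cocycle A \<Gamma> E \<iota> s f) \<and>
           (\<forall>f. section_cocycle A \<Gamma> E \<iota> s f \<longrightarrow>
              f \<in> carrier (RZ2 A \<Gamma>) \<and>
              RH2_class A \<Gamma> E \<iota> \<pi> = RB2 A \<Gamma> #>\<^bsub>RZ2 A \<Gamma>\<^esub> f))) \<and>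
     (\<forall>(E :: 'e lcs) \<iota> \<pi> (E' :: 'f lcs) \<iota>' \<pi>'.
        central_ct_extension A \<Gamma> E \<iota> \<pi> \<longrightarrow> central_ct_extension A \<Gamma> E' \<iota>' \<pi>' \<longrightarrow>
        (equivalent_extensions \<Gamma> E \<iota> \<pi> E' \<iota>' \<pi>' \<longleftrightarrow>
         RH2_class A \<Gamma> E \<iota> \<pi> = RH2_class A \<Gamma> E' \<iota>' \<pi>')) \<and>
     (\<forall>(E :: 'e lcs) \<iota> \<pi>. central_ct_extension A \<Gamma> E \<iota> \<pi> \<longrightarrow>
        (\<exists>(E' :: ('g \<times> 'a) lcs) \<iota>' \<pi>'.
           central_ct_extension A \<Gamma> E' \<iota>' \<pi>' \<and> equivalent_extensions \<Gamma> E \<iota> \<pi> E' \<iota>' \<pi>')) \<and>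
     (\<forall>C\<in>(CTExt A \<Gamma> :: ('g, 'g \<times> 'a, 'a) extension set set). \<forall>(E, \<iota>, \<pi>)\<in>C.
        CTExt_to_RH2 A \<Gamma> C = RH2_class A \<Gamma> E \<iota> \<pi>) \<and>
     bij_betw (CTExt_to_RH2 A \<Gamma>)
       (CTExt A \<Gamma> :: ('g, 'g \<times> 'a, 'a) extension set set) (carrier (RH2 A \<Gamma>))"
proof -
  interpret lcs_coefficients A \<Gamma>
    using assms by (rule lcs_coefficients.intro)
  \<comment> \<open>The carriers lie in the type of pairs, where the models live, so every
    cohomology class is attained within this set.\<close>
  let ?S = "{(E, \<iota>, \<pi>). central_ct_extension A \<Gamma> E \<iota> \<pi>} :: ('g, 'g \<times> 'a, 'a) extension set"
  let ?F = "\<lambda>(E, \<iota>, \<pi>). RH2_class A \<Gamma> E \<iota> \<pi>"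
  have "?F ` ?S = carrier (RH2 A \<Gamma>)"
  proof
    show "?F ` ?S \<subseteq> carrier (RH2 A \<Gamma>)"
      by (auto simp: RH2_class_closed)
    show "carrier (RH2 A \<Gamma>) \<subseteq> ?F ` ?S"
    proof
      fix c assume "c \<in> carrier (RH2 A \<Gamma>)"
      then obtain f where "f \<in> carrier (RZ2 A \<Gamma>)"
        "RH2_class A \<Gamma> (cocycle_lcs A \<Gamma> f) cocycle_incl snd = c"
        by (rule RH2_class_surj)
      then show "c \<in> ?F ` ?S"
        by (intro image_eqI[of _ _ "(cocycle_lcs A \<Gamma> f, cocycle_incl, snd)"])
          (auto simp: cocycle_lcs_extension)
    qed
  qed
  \<comment> \<open>With \<open>CTExt\<close> rewritten as a quotient by a kernel relation, the
    general bijection onto the image of the class map becomes one onto \<open>RH2\<close>.\<close>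
  then have bij: "bij_betw (CTExt_to_RH2 A \<Gamma>)
      (CTExt A \<Gamma> :: ('g, 'g \<times> 'a, 'a) extension set set) (carrier (RH2 A \<Gamma>))"
    using bij_betw_quotient_kernel[of ?F ?S]
    unfolding CTExt_eq_quotient_kernel CTExt_to_RH2_def[abs_def] by simp
  have class_eq: "CTExt_to_RH2 A \<Gamma> C = RH2_class A \<Gamma> E \<iota> \<pi>"
    if "C \<in> (CTExt A \<Gamma> :: ('g, 'g \<times> 'a, 'a) extension set set)" "(E, \<iota>, \<pi>) \<in> C" for C E \<iota> \<pi>
    using the_elem_image_kernel_class[of C ?S ?F "(E, \<iota>, \<pi>)"] that
    unfolding CTExt_eq_quotient_kernel CTExt_to_RH2_def by simp
  have nonempty: "additive_sections A E \<pi> \<noteq> {}"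
    if "central_ct_extension A \<Gamma> E \<iota> \<pi>" for E :: "'e lcs" and \<iota> \<pi>
    using that by (simp add: central_ct_extension_def)
  have small: "\<exists>(E' :: ('g \<times> 'a) lcs) \<iota>' \<pi>'.
      central_ct_extension A \<Gamma> E' \<iota>' \<pi>' \<and> equivalent_extensions \<Gamma> E \<iota> \<pi> E' \<iota>' \<pi>'"
    if "central_ct_extension A \<Gamma> E \<iota> \<pi>" for E :: "'e lcs" and \<iota> \<pi>
    using equivalent_to_cocycle_lcs[OF that] cocycle_lcs_extension by metis
  show ?thesis
  proof (intro conjI)
    show "\<forall>(E :: 'e lcs) \<iota> \<pi>. central_ct_extension A \<Gamma> E \<iota> \<pi> \<longrightarrow>
        additive_sections A E \<pi> \<noteq> {} \<and>
        (\<forall>s\<in>additive_sections A E \<pi>.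
           (\<exists>!f. section_cocycle A \<Gamma> E \<iota> s f) \<and>
           (\<forall>f. section_cocycle A \<Gamma> E \<iota> s f \<longrightarrow>
              f \<in> carrier (RZ2 A \<Gamma>) \<and>
              RH2_class A \<Gamma> E \<iota> \<pi> = RB2 A \<Gamma> #>\<^bsub>RZ2 A \<Gamma>\<^esub> f))"
      by (intro allI impI ballI conjI) (rule nonempty section_cocycle_class; assumption)+
    show "\<forall>(E :: 'e lcs) \<iota> \<pi> (E' :: 'f lcs) \<iota>' \<pi>'.
        central_ct_extension A \<Gamma> E \<iota> \<pi> \<longrightarrow> central_ct_extension A \<Gamma> E' \<iota>' \<pi>' \<longrightarrow>
        (equivalent_extensions \<Gamma> E \<iota> \<pi> E' \<iota>' \<pi>' \<longleftrightarrow>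
         RH2_class A \<Gamma> E \<iota> \<pi> = RH2_class A \<Gamma> E' \<iota>' \<pi>')"
      by (intro allI impI) (rule equivalent_iff_RH2_class_eq)
    show "\<forall>(E :: 'e lcs) \<iota> \<pi>. central_ct_extension A \<Gamma> E \<iota> \<pi> \<longrightarrow>
        (\<exists>(E' :: ('g \<times> 'a) lcs) \<iota>' \<pi>'.
           central_ct_extension A \<Gamma> E' \<iota>' \<pi>' \<and> equivalent_extensions \<Gamma> E \<iota> \<pi> E' \<iota>' \<pi>')"
      by (intro allI impI) (rule small)
    show "\<forall>C\<in>(CTExt A \<Gamma> :: ('g, 'g \<times> 'a, 'a) extension set set). \<forall>(E, \<iota>, \<pi>)\<in>C.
        CTExt_to_RH2 A \<Gamma> C = RH2_class A \<Gamma> E \<iota> \<pi>"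
      using class_eq by blast
  qed (rule bij)
qed

end
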